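(* Let $q\ge3$ be an integer, and let $\mathsf{S}$, $\mathsf{V}_i^q$, $\mathsf{H}_i^q$, $\rho_i^q$, $M_i^q$ ($0\le i\le q-2$) be as defined in the context. Let $\widetilde{\mathscr{F}}_q:\mathsf{S}\to\mathsf{S}$ be the map that, for each $i\in\{0,\dots,q-2\}$, sends $(a,s)\in\mathsf{V}_i^q$ to the point $(a',s')$ determined by $$h_{s'}g_{a',1-a'}=g_{-\log\rho_i^q(a)}h_sg_{a,1-a}\left((M_i^q)^{-1}\right)^T.$$ Then $\widetilde{\mathscr{F}}_q$ preserves the Lebesgue measure $da\,ds$ on $\mathsf{S}$, and it satisfies the Markov condition $\widetilde{\mathscr{F}}_q(\mathsf{V}_i^q)=\mathsf{H}_{q-2-i}^q$ for all $i\in\{0,\dots,q-2\}$. Consequently, $\widetilde{\mathscr{F}}_q$ is a model of the natural extension of the map $\mathscr{F}_q:(0,1]\to(0,1]$ defined, for all $i\in\{0,\dots,q-2\}$ and $$a\in I_i^q:=\left(\frac{1}{1+\mathrm{slope}(\mathfrak{w}_{i+1}^q)},\frac{1}{1+\mathrm{slope}(\mathfrak{w}_i^q)}\right]=\left(\frac{x_{i+1}^q}{x_{i+1}^q+y_{i+1}^q},\frac{x_i^q}{x_i^q+y_i^q}\right],$$ by $$\mathscr{F}_q(a):=\frac{1}{1+\mathrm{slope}\left((M_i^q)^{-1}(a,1-a)^T\right)}=\frac{(x_{i+1}^q+y_{i+1}^q)a-x_{i+1}^q}{(x_{i+1}^q-y_i^q)a+(x_i^q-x_{i+1}^q)}.$$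 Moreover, $\mathscr{F}_q$ preserves the measure $$d\mu_{\mathscr{F}_q}:=\frac{da}{a(1-a)}$$ on $(0,1]$.
   Context: Let $q\ge3$ be an integer and $\lambda_q:=2\cos(\pi/q)$. Put $T_q:=\begin{pmatrix}1&\lambda_q\\0&1\end{pmatrix}$, $U_q:=\begin{pmatrix}\lambda_q&-1\\1&0\end{pmatrix}$ and, for $i=0,1,\dots,q-1$, $\mathfrak{w}_i^q=(x_i^q,y_i^q)^T:=U_q^i(1,0)^T$. (So $\mathfrak{w}_0^q=(1,0)^T$, $\mathfrak{w}_1^q=(\lambda_q,1)^T$, $\mathfrak{w}_{q-2}^q=(1,\lambda_q)^T$, $\mathfrak{w}_{q-1}^q=(0,1)^T$.) For $i=0,\dots,q-2$, $M_i^q:=U_q^iT_q$ is the matrix whose columns are $\mathfrak{w}_i^q$ and $\mathfrak{w}_{i+1}^q$, and $\rho_i^q(a):=(x_{i+1}^q-y_i^q)a+(x_i^q-x_{i+1}^q)$. Matrices: $h_s:=\begin{pmatrix}1&0\\-s&1\end{pmatrix}$, $g_t:=\begin{pmatrix}e^t&0\\0&e^{-t}\end{pmatrix}$ for $s,t\in\mathbb{R}$, and $g_{a,b}:=\begin{pmatrix}a&b\\0&a^{-1}\end{pmatrix}$ for $a>0$, $b\in\mathbb{R}$. For a vector, $\mathrm{slope}((x,y)^T):=y/x$, with $\mathrm{slope}(\mathfrak{w}_{q-1}^q)=+\infty$ and $\frac{1}{1+\infty}=0$. For $i=0,\dots,q-1$, $R_{q,i}(a,b):=\dfrac{y_i^q}{a(x_i^qa+y_i^qb)}$,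 so $R_{q,0}=0$ and $R_{q,q-1}(a,1-a)=\frac{1}{a(1-a)}$, with the convention that this is $+\infty$ at $a=1$. $\mathsf{S}:=\{(a,s)\in\mathbb{R}^2\mid a\in(0,1],\ 0\le s<\frac{1}{a(1-a)}\}$ (with $\frac{1}{a(1-a)}=+\infty$ at $a=1$), and for $i=0,\dots,q-2$: $\mathsf{H}_i^q:=\{(a,s)\in\mathsf{S}\mid R_{q,i}(a,1-a)\le s<R_{q,i+1}(a,1-a)\}$, and $\mathsf{V}_i^q:=\{(a,s)\in\mathsf{S}\mid \mathrm{slope}(\mathfrak{w}_i^q)\le\mathrm{slope}((a,1-a)^T)<\mathrm{slope}(\mathfrak{w}_{i+1}^q)\}$ (equivalently, $a\in I_i^q$). "Natural extension" is meant in the usual sense, with factor map the projection $\pi(a,s)=a$: $\widetilde{\mathscr{F}}_q$ is an (essentially) invertible measure-preserving map of $\mathsf{S}$, $\pi\circ\widetilde{\mathscr{F}}_q=\mathscr{F}_q\circ\pi$, the measure on $(0,1]$ is obtained by integrating $da\,ds$ over the $s$-fibers of $\pi$, and, modulo null sets, the Borel $\sigma$-algebra of $\mathsf{S}$ is generated by $\bigcup_{n\ge0}\widetilde{\mathscr{F}}_q^{\,n}\left(\pi^{-1}\mathcal{B}\right)$, where $\mathcal{B}$ is the Borel $\sigma$-algebra of $(0,1]$. *)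

theory Defs
  imports "HOL-Analysis.Analysis"
begin

section \<open>Measure-preserving maps and natural extensions\<close>

definition measure_preserving_map :: "'a measure \<Rightarrow> ('a \<Rightarrow> 'a) \<Rightarrow> bool" where
  "measure_preserving_map N f \<longleftrightarrow> f \<in> measurable N N \<and> distr N N f = N"

definition essentially_invertible :: "'a measure \<Rightarrow> ('a \<Rightarrow> 'a) \<Rightarrow> bool" where
  "essentially_invertible N f \<longleftrightarrow>
     (\<exists>g \<in> measurable N N. (AE x in N. g (f x) = x) \<and> (AE x in N. f (g x) = x))"

text \<open>The \<open>\<sigma>\<close>-algebra on \<open>space N\<close> generated by the forward images under \<open>f\<close> of the
  \<open>\<sigma>\<close>-algebra of the factor \<open>M\<close>. For a map that is only essentially invertible the
  forward images need not belong to \<open>sets N\<close>, whence the completion in the definition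
  of natural extension below.\<close>

definition forward_generated :: "'a measure \<Rightarrow> ('a \<Rightarrow> 'a) \<Rightarrow> 'b measure \<Rightarrow> ('a \<Rightarrow> 'b) \<Rightarrow> 'a set set" where
  "forward_generated N f M \<pi> =
     sigma_sets (space N) (\<Union>n. {(f ^^ n) ` (\<pi> -` B \<inter> space N) | B. B \<in> sets M})"

definition equal_mod_null :: "'a measure \<Rightarrow> 'a set set \<Rightarrow> 'a set set \<Rightarrow> bool" where
  "equal_mod_null N \<A> \<B> \<longleftrightarrow>
     (\<forall>A\<in>\<A>. \<exists>B\<in>\<B>. (A - B) \<union> (B - A) \<in> null_sets (completion N)) \<and>
     (\<forall>B\<in>\<B>. \<exists>A\<in>\<A>. (A - B) \<union> (B - A) \<in> null_sets (completion N))"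

text \<open>\<open>(N, f)\<close> is a natural extension of \<open>(M, g)\<close> with factor map \<open>\<pi>\<close>. The condition
  \<open>distr N M \<pi> = M\<close> says that the measure of the factor is obtained by integrating the
  measure of the extension over the fibers of \<open>\<pi>\<close>.\<close>

definition natural_extension ::
  "'a measure \<Rightarrow> ('a \<Rightarrow> 'a) \<Rightarrow> 'b measure \<Rightarrow> ('b \<Rightarrow> 'b) \<Rightarrow> ('a \<Rightarrow> 'b) \<Rightarrow> bool" where
  "natural_extension N f M g \<pi> \<longleftrightarrow>
     measure_preserving_map N f \<and> essentially_invertible N f \<and>
     \<pi> \<in> measurable N M \<and> distr N M \<pi> = M \<and>
     (\<forall>x\<in>space N. \<pi> (f x) = g (\<pi> x)) \<and>
     equal_mod_null N (sets N) (forward_generated N f M \<pi>)"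


section \<open>Matrices and vectors\<close>

definition hecke_lambda :: "nat \<Rightarrow> real" where
  "hecke_lambda q = 2 * cos (pi / real q)"

definition hecke_T :: "nat \<Rightarrow> real^2^2" where
  "hecke_T q = vector [vector [1, hecke_lambda q], vector [0, 1]]"

definition hecke_U :: "nat \<Rightarrow> real^2^2" where
  "hecke_U q = vector [vector [hecke_lambda q, -1], vector [1, 0]]"

primrec mat_power :: "real^2^2 \<Rightarrow> nat \<Rightarrow> real^2^2" where
  "mat_power A 0 = mat 1"
| "mat_power A (Suc n) = A ** mat_power A n"

definition hecke_w :: "nat \<Rightarrow> nat \<Rightarrow> real^2" where
  "hecke_w q i = mat_power (hecke_U q) i *v vector [1, 0]"

definition wx :: "nat \<Rightarrow> nat \<Rightarrow> real" where
  "wx q i = hecke_w q i $ 1"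

definition wy :: "nat \<Rightarrow> nat \<Rightarrow> real" where
  "wy q i = hecke_w q i $ 2"

definition hecke_M :: "nat \<Rightarrow> nat \<Rightarrow> real^2^2" where
  "hecke_M q i = mat_power (hecke_U q) i ** hecke_T q"

definition hecke_rho :: "nat \<Rightarrow> nat \<Rightarrow> real \<Rightarrow> real" where
  "hecke_rho q i a = (wx q (i + 1) - wy q i) * a + (wx q i - wx q (i + 1))"

definition h_mat :: "real \<Rightarrow> real^2^2" where
  "h_mat s = vector [vector [1, 0], vector [- s, 1]]"

definition g_diag :: "real \<Rightarrow> real^2^2" where
  "g_diag t = vector [vector [exp t, 0], vector [0, exp (- t)]]"

definition g_upper :: "real \<Rightarrow> real \<Rightarrow> real^2^2" where
  "g_upper a b = vector [vector [a, b], vector [0, inverse a]]"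

text \<open>Vertical vectors have slope \<open>+\<infinity>\<close>; the only one that occurs is \<open>hecke_w q (q - 1) = (0, 1)\<close>.
  In \<^typ>\<open>ereal\<close>, \<open>1 / (1 + \<infinity>) = 0\<close>.\<close>

definition slope :: "real^2 \<Rightarrow> ereal" where
  "slope v = (if v $ 1 = 0 then \<infinity> else ereal (v $ 2 / v $ 1))"


section \<open>The domain and its partitions\<close>

text \<open>In \<^typ>\<open>ereal\<close>, division of a positive number by \<open>0\<close> gives \<open>+\<infinity>\<close>. This yields the
  required conventions at \<open>a = 1\<close> in the next two definitions.\<close>

definition R_fun :: "nat \<Rightarrow> nat \<Rightarrow> real \<Rightarrow> real \<Rightarrow> ereal" where
  "R_fun q i a b = ereal (wy q i) / ereal (a * (wx q i * a + wy q i * b))"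

definition S_dom :: "(real \<times> real) set" where
  "S_dom = {(a, s). 0 < a \<and> a \<le> 1 \<and> 0 \<le> s \<and> ereal s < 1 / ereal (a * (1 - a))}"

definition H_set :: "nat \<Rightarrow> nat \<Rightarrow> (real \<times> real) set" where
  "H_set q i = {(a, s) \<in> S_dom.
     R_fun q i a (1 - a) \<le> ereal s \<and> ereal s < R_fun q (i + 1) a (1 - a)}"

definition V_set :: "nat \<Rightarrow> nat \<Rightarrow> (real \<times> real) set" where
  "V_set q i = {(a, s) \<in> S_dom.
     slope (hecke_w q i) \<le> slope (vector [a, 1 - a]) \<and>
     slope (vector [a, 1 - a]) < slope (hecke_w q (i + 1))}"

definition I_set :: "nat \<Rightarrow> nat \<Rightarrow> real set" where
  "I_set q i = {a. 1 / (1 + slope (hecke_w q (i + 1))) < ereal a \<and>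
                   ereal a \<le> 1 / (1 + slope (hecke_w q i))}"


section \<open>The two maps\<close>

text \<open>The condition \<open>0 < a'\<close> is the domain condition for the matrix \<open>g_upper a' (1 - a')\<close>.\<close>

definition Ftilde_rel :: "nat \<Rightarrow> nat \<Rightarrow> real \<times> real \<Rightarrow> real \<times> real \<Rightarrow> bool" where
  "Ftilde_rel q i = (\<lambda>(a, s) (a', s'). 0 < a' \<and>
     h_mat s' ** g_upper a' (1 - a') =
     g_diag (- ln (hecke_rho q i a)) ** h_mat s ** g_upper a (1 - a)
       ** transpose (matrix_inv (hecke_M q i)))"

definition Ftilde :: "nat \<Rightarrow> real \<times> real \<Rightarrow> real \<times> real" where
  "Ftilde q p = (THE p'. \<exists>i \<le> q - 2. p \<in> V_set q i \<and> Ftilde_rel q i p p')"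

definition F_map :: "nat \<Rightarrow> real \<Rightarrow> real" where
  "F_map q a = (THE b. \<exists>i \<le> q - 2. a \<in> I_set q i \<and>
     ereal b = 1 / (1 + slope (matrix_inv (hecke_M q i) *v vector [a, 1 - a])))"

definition S_measure :: "(real \<times> real) measure" where
  "S_measure = restrict_space lborel S_dom"

definition mu_F :: "real measure" where
  "mu_F = density (restrict_space lborel {0<..1}) (\<lambda>a. ennreal (1 / (a * (1 - a))))"

end

theory Submission
  imports Defs
begin

text \<open>In the coordinates \<open>u = (1 - a) / a\<close> and \<open>t = s a\<^sup>2 / (1 - s a (1 - a))\<close>, the slopes of the two
  rows of \<open>h_mat s ** g_upper a (1 - a)\<close> up to sign and inversion, the domain becomes the quadrant
  \<open>[0, \<infinity>) \<times> [0, \<infinity>)\<close>. With the increasing Moebius maps \<open>B\<^sub>i\<close> taking \<open>[0, \<infinity>)\<close> onto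
  \<open>C\<^sub>i = [slope (w i), slope (w (i + 1)))\<close>, the extension is \<open>(B\<^sub>i u, t) \<mapsto> (u, B\<^bsub>q-2-i\<^esub> t)\<close>, the vertical
  pieces are \<open>u \<in> C\<^sub>i\<close> and the horizontal ones \<open>t \<in> C\<^sub>j\<close>. Hence the Markov condition, and the inverse
  map is the conjugate of the map by the swap of \<open>u\<close> and \<open>t\<close>. On each vertical piece the map is affine
  on the fibers with factor \<open>\<rho>\<^sup>2\<close> over an interval map with derivative \<open>1 / \<rho>\<^sup>2\<close>, so it preserves area.

  Forward images of the base generate the Borel sets as soon as the images of \<open>0\<close> under compositions
  of the \<open>B\<^sub>i\<close> are dense in \<open>[0, \<infinity>)\<close>; that holds since an interval avoiding them would pull back to
  ever longer such intervals, while the multiples of \<open>\<lambda>\<^sub>q\<close>, the images of \<open>0\<close> under the translation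
  \<open>B\<^bsub>q-2\<^esub>\<close>, bound their length.\<close>

section \<open>The orbit of the first basis vector\<close>

lemma wx_0 [simp]: "wx q 0 = 1" and wy_0 [simp]: "wy q 0 = 0"
  by (simp_all add: wx_def wy_def hecke_w_def)

lemma hecke_w_Suc: "hecke_w q (Suc i) = hecke_U q *v hecke_w q i"
  by (simp add: hecke_w_def matrix_vector_mul_assoc)

lemma wx_Suc: "wx q (Suc i) = hecke_lambda q * wx q i - wy q i"
  and wy_Suc [simp]: "wy q (Suc i) = wx q i"
  by (simp_all add: wx_def wy_def hecke_w_Suc hecke_U_def matrix_vector_mult_def sum_2)

text \<open>The left side is the determinant of \<open>hecke_M q i\<close>; the recurrence preserves
  it because \<open>hecke_U q\<close> has determinant one.\<close>

lemma wx_det: "wx q i * wx q i - wx q (Suc i) * wy q i = 1"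
proof (induction i)
  case (Suc i)
  then show ?case by (simp add: wx_Suc algebra_simps)
qed simp

text \<open>\<open>matrix_inv\<close> is defined by choice, so its value is pinned down through
  uniqueness of two-sided inverses.\<close>

lemma matrix_inv_2:
  fixes a b c d :: real
  assumes "a * d - b * c = 1"
  shows "matrix_inv (vector [vector [a, b], vector [c, d]] :: real^2^2) = vector [vector [d, -b], vector [-c, a]]"
    (is "matrix_inv ?A = ?B")
proof -
  have AB: "?A ** ?B = mat 1" "?B ** ?A = mat 1"
    using assms by (simp_all add: vec_eq_iff forall_2 matrix_matrix_mult_def sum_2 mat_def algebra_simps)
  show ?thesis unfolding matrix_inv_def
  proof (rule some_equality)
    fix C assume "?A ** C = mat 1 \<and> C ** ?A = mat 1"
    then have "C ** (?A ** ?B) = ?B" by (simp add: matrix_mul_assoc)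
    then show "C = ?B" by (simp only: AB matrix_mul_rid)
  qed (use AB in simp)
qed

lemma hecke_M_eq:
  "hecke_M q i = vector [vector [wx q i, wx q (Suc i)], vector [wy q i, wx q i]]"
proof -
  have "hecke_M q i *v vector [1, 0] = hecke_w q i"
    by (simp add: hecke_M_def hecke_w_def flip: matrix_vector_mul_assoc)
       (simp add: hecke_T_def matrix_vector_mult_def sum_2 vector_def forall_2 vec_eq_iff)
  moreover have "hecke_M q i *v vector [0, 1] = hecke_w q (Suc i)"
  proof -
    have commute: "mat_power A n ** A = A ** mat_power A n" for A :: "real^2^2" and n
      by (induction n) (simp_all flip: matrix_mul_assoc)
    \<comment> \<open>The second column of \<open>hecke_T q\<close> is the first column of
      \<open>hecke_U q\<close>, so the second column of \<open>hecke_M q i\<close> lies one step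
      further along the orbit.\<close>
    have "hecke_T q *v vector [0, 1] = hecke_U q *v vector [1, 0]"
      by (simp add: hecke_T_def hecke_U_def matrix_vector_mult_def sum_2 forall_2 vec_eq_iff)
    then have "hecke_M q i *v vector [0, 1] = mat_power (hecke_U q) i *v (hecke_U q *v vector [1, 0])"
      by (simp only: hecke_M_def flip: matrix_vector_mul_assoc)
    then show ?thesis
      by (simp only: matrix_vector_mul_assoc commute hecke_w_def mat_power.simps)
  qed
  ultimately show ?thesis
    using wy_Suc[of q i]
    by (simp add: vec_eq_iff forall_2 wx_def wy_def matrix_vector_mult_def sum_2)
qed

lemma matrix_inv_hecke_M:
  "matrix_inv (hecke_M q i) = vector [vector [wx q i, - wx q (Suc i)], vector [- wy q i, wx q i]]"
  unfolding hecke_M_eq by (rule matrix_inv_2) (rule wx_det)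

section \<open>Sine formulas, positivity and reflection of the orbit\<close>

locale hecke =
  fixes q :: nat
  assumes q_ge_3: "q \<ge> 3"
begin

abbreviation X where "X \<equiv> wx q"
abbreviation Y where "Y \<equiv> wy q"

text \<open>By the addition formulas the sines of multiples of \<open>pi / q\<close> obey the
  recurrence of the orbit. Each step uses both coordinates, hence the joint induction.\<close>

lemma wx_sin: "X i * sin (pi / q) = sin (real (Suc i) * (pi / q))"
  and wy_sin: "Y i * sin (pi / q) = sin (real i * (pi / q))"
proof (induction i)
  case (Suc i)
  have sum: "sin (real (Suc (Suc i)) * (pi / q)) + sin (real i * (pi / q)) = 
     2 * cos (pi / q) * sin (real (Suc i) * (pi / q))"
    using sin_add[of "real (Suc i) * (pi / q)" "pi / q"] sin_diff[of "real (Suc i) * (pi / q)" "pi / q"]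
    by (simp add: add_divide_distrib distrib_left distrib_right)
  {
    case 1
    from Suc sum show ?case
      by (simp add: wx_Suc hecke_lambda_def algebra_simps)
  next
    case 2
    from Suc show ?case by simp
  }
qed simp_all

lemma sin_pos: "sin (pi / q) > 0"
  using q_ge_3 by (intro sin_gt_zero) (auto simp: field_simps)

text \<open>Since the sine is symmetric about \<open>pi / 2\<close>, reversing the orbit exchanges
  the two coordinates.\<close>

lemma wx_wy_reflect:
  assumes "i < q"
  shows "X i = Y (q - Suc i)"
proof -
  have "real (q - Suc i) * (pi / q) = pi - real (Suc i) * (pi / q)"
    using assms by (simp add: of_nat_diff field_simps)
  then have "X i * sin (pi / q) = Y (q - Suc i) * sin (pi / q)"
    unfolding wx_sin wy_sin by (metis sin_pi_minus)
  then show ?thesis using sin_pos by simp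
qed

lemma wx_last [simp]: "X (q - Suc 0) = 0"
  using wx_wy_reflect[of "q - Suc 0"] q_ge_3 by simp

text \<open>The angle \<open>Suc i * (pi / q)\<close> lies between \<open>pi / q\<close> and
  \<open>pi - pi / q\<close>, where the sine is at least its value at the two ends.\<close>

lemma wx_ge_1:
  assumes "i \<le> q - 2"
  shows "X i \<ge> 1"
proof -
  have "sin (pi / q) \<le> sin (real (Suc i) * (pi / q))"
  proof (cases "real (Suc i) * (pi / q) \<le> pi / 2")
    case True
    then show ?thesis
    proof (intro sin_monotone_2pi_le)
      show "- (pi / 2) \<le> pi / real q" by (rule order_trans[of _ 0]) auto
    qed (use q_ge_3 in \<open>auto simp: field_simps\<close>)
  next
    case False
    have "sin (pi / q) \<le> sin (pi - real (Suc i) * (pi / q))"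
    proof (rule sin_monotone_2pi_le)
      have "real (Suc (Suc i)) \<le> real q"
        using assms q_ge_3 by linarith
      then have "real (Suc (Suc i)) * pi \<le> real q * pi" by (intro mult_right_mono) auto
      then show "pi / q \<le> pi - real (Suc i) * (pi / q)"
        using q_ge_3 by (simp add: field_simps)
      show "- (pi / 2) \<le> pi / real q" by (rule order_trans[of _ 0]) auto
    qed (use False in linarith)
    then show ?thesis by simp
  qed
  then have "1 * sin (pi / q) \<le> X i * sin (pi / q)" unfolding wx_sin by simp
  then show ?thesis using sin_pos by (simp only: mult_le_cancel_right_pos)
qed

lemma wx_nonneg:
  assumes "i < q"
  shows "X i \<ge> 0"
proof (cases "i \<le> q - 2")
  case True
  then show ?thesis using wx_ge_1[of i] by simp
next
  case False
  then have "i = q - Suc 0" using assms by linarith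
  then show ?thesis by simp
qed

lemma wy_nonneg:
  assumes "i \<le> q"
  shows "Y i \<ge> 0"
  using assms wx_nonneg by (cases i) auto

text \<open>Together these equations say that \<open>hecke_M q (q - 2 - i)\<close> is the transpose
  of \<open>hecke_M q i\<close>. This is the origin of the index reversal in the Markov
  condition.\<close>

lemma wx_reflect: "i \<le> q - 2 \<Longrightarrow> X (q - 2 - i) = X i"
  and wy_reflect: "i \<le> q - 2 \<Longrightarrow> Y (q - 2 - i) = X (Suc i)"
  and wx_Suc_reflect: "i \<le> q - 2 \<Longrightarrow> X (Suc (q - 2 - i)) = Y i"
proof -
  assume i: "i \<le> q - 2"
  have "q - Suc i = Suc (q - 2 - i)" "q - Suc (Suc i) = q - 2 - i" "q - Suc (Suc (q - 2 - i)) = i"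
    using i q_ge_3 by linarith+
  moreover have "i < q" "Suc i < q" "Suc (q - 2 - i) < q" using i q_ge_3 by linarith+
  ultimately show "X (q - 2 - i) = X i" "Y (q - 2 - i) = X (Suc i)" "X (Suc (q - 2 - i)) = Y i"
    using wx_wy_reflect by (metis wy_Suc, metis, metis)
qed

text \<open>The slopes from \<open>w\<^sub>i\<close> up to \<open>w\<^bsub>i+1\<^esub>\<close>, cleared of denominators so that the infinite slope of the
  last vector needs no special treatment.\<close>

definition cell :: "nat \<Rightarrow> real set" where
  "cell i = {u. Y i \<le> X i * u \<and> X (Suc i) * u < X i}"

text \<open>The Moebius action of \<open>hecke_M q i\<close> on slopes: the vector
  \<open>(1, u)\<close> is sent to one of slope \<open>branch i u\<close>. Likewise
  \<open>branch_inv\<close> is the action of the inverse matrix.\<close>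

definition branch :: "nat \<Rightarrow> real \<Rightarrow> real" where
  "branch i u = (X i * u + Y i) / (X (Suc i) * u + X i)"

definition branch_inv :: "nat \<Rightarrow> real \<Rightarrow> real" where
  "branch_inv i v = (X i * v - Y i) / (X i - X (Suc i) * v)"

context
  fixes i assumes i: "i \<le> q - 2"
begin

lemma entries: "X i \<ge> 1" "X (Suc i) \<ge> 0" "Y i \<ge> 0" "X i * X i = 1 + X (Suc i) * Y i"
  using wx_ge_1[OF i] wx_nonneg[of "Suc i"] wy_nonneg[of i] wx_det[of q i] i q_ge_3 by auto

lemma branch_denom_pos: "u \<ge> 0 \<Longrightarrow> X (Suc i) * u + X i \<ge> 1"
  using entries by (smt (verit) mult_nonneg_nonneg)

lemma cell_nonneg: "u \<in> cell i \<Longrightarrow> u \<ge> 0"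
  using entries unfolding cell_def by (smt (verit) mem_Collect_eq mult_pos_neg)

text \<open>After cross-multiplication the two defining inequalities of the cell have differences
  \<open>u\<close> and 1, each times the determinant.\<close>

lemma branch_in_cell:
  assumes "u \<ge> 0"
  shows "branch i u \<in> cell i"
proof -
  have "X i * (X i * u + Y i) - Y i * (X (Suc i) * u + X i) = u * (X i * X i - X (Suc i) * Y i)"
    "X i * (X (Suc i) * u + X i) - X (Suc i) * (X i * u + Y i) = X i * X i - X (Suc i) * Y i"
    by algebra+
  then have "Y i * (X (Suc i) * u + X i) \<le> X i * (X i * u + Y i)"
    "X (Suc i) * (X i * u + Y i) < X i * (X (Suc i) * u + X i)"
    using entries assms by simp_all
  then show ?thesis
    using branch_denom_pos[OF assms] by (simp add: cell_def branch_def pos_le_divide_eq pos_divide_less_eq)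
qed

lemma branch_nonneg: "u \<ge> 0 \<Longrightarrow> branch i u \<ge> 0"
  using cell_nonneg branch_in_cell by blast

lemma branch_inv_nonneg: "v \<in> cell i \<Longrightarrow> branch_inv i v \<ge> 0"
  by (simp add: cell_def branch_inv_def)

lemma branch_branch_inv:
  assumes "v \<in> cell i"
  shows "branch i (branch_inv i v) = v"
proof -
  have "X i - X (Suc i) * v > 0" using assms by (simp add: cell_def)
  then have "branch i (branch_inv i v) =
      (X i * (X i * v - Y i) + Y i * (X i - X (Suc i) * v)) /
      (X (Suc i) * (X i * v - Y i) + X i * (X i - X (Suc i) * v))"
    unfolding branch_def branch_inv_def by (simp add: divide_simps)
  also have "X i * (X i * v - Y i) + Y i * (X i - X (Suc i) * v) = v * (X i * X i - X (Suc i) * Y i)"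
    by algebra
  also have "X (Suc i) * (X i * v - Y i) + X i * (X i - X (Suc i) * v) = X i * X i - X (Suc i) * Y i"
    by algebra
  finally show ?thesis using entries by simp
qed

text \<open>The usual difference formula for a Moebius map of determinant one. It gives monotonicity
  here and the stretching of gaps later.\<close>

lemma branch_diff:
  assumes "u \<ge> 0" "v \<ge> 0"
  shows "branch i v - branch i u = (v - u) / ((X (Suc i) * u + X i) * (X (Suc i) * v + X i))"
proof -
  have "(X i * v + Y i) * (X (Suc i) * u + X i) - (X i * u + Y i) * (X (Suc i) * v + X i) =
     (v - u) * (X i * X i - X (Suc i) * Y i)"
    by algebra
  then show ?thesis
    using entries branch_denom_pos[OF assms(1)] branch_denom_pos[OF assms(2)]
    by (simp add: branch_def diff_frac_eq mult.commute)
qed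

lemma branch_less_iff:
  assumes "u \<ge> 0" "v \<ge> 0"
  shows "branch i u < branch i v \<longleftrightarrow> u < v"
proof -
  have "(X (Suc i) * u + X i) * (X (Suc i) * v + X i) > 0"
    using branch_denom_pos[OF assms(1)] branch_denom_pos[OF assms(2)] by simp
  then show ?thesis
    using branch_diff[OF assms] by (smt (verit) zero_less_divide_iff divide_pos_pos divide_less_0_iff)
qed

lemma branch_inj: "u \<ge> 0 \<Longrightarrow> v \<ge> 0 \<Longrightarrow> branch i u = branch i v \<longleftrightarrow> u = v"
  using branch_less_iff by (metis less_irrefl linorder_neqE)

lemma branch_inv_branch:
  assumes "u \<ge> 0"
  shows "branch_inv i (branch i u) = u"
  using branch_branch_inv branch_in_cell branch_inv_nonneg assms branch_inj by blast

end

text \<open>The slopes of the orbit vectors increase, because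
  \<open>X (Suc n) * Y n = X n * X n - 1\<close>. The form without division covers the vertical last
  vector.\<close>

lemma cell_bound_mono:
  assumes "i \<le> j" "j < q" "u \<ge> 0" "Y j \<le> X j * u"
  shows "Y i \<le> X i * u"
  using assms
proof (induction j rule: dec_induct)
  case (step n)
  have n: "n \<le> q - 2" using step.prems by linarith
  show ?case
  proof (rule step.IH)
    show "Y n \<le> X n * u"
    proof (rule mult_left_le_imp_le)
      have "X (Suc n) * Y n \<le> X n * X n" using entries[OF n] by simp
      also have "\<dots> \<le> X n * (X (Suc n) * u)" using step.prems entries[OF n] by (intro mult_left_mono) auto
      finally show "X (Suc n) * Y n \<le> X (Suc n) * (X n * u)" by (simp add: mult_ac)
      \<comment> \<open>If \<open>X (Suc n)\<close> were 0, the assumption on \<open>u\<close> would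
        read \<open>X n \<le> 0\<close>, against \<open>X n \<ge> 1\<close>.\<close>
      show "X (Suc n) > 0"
        using step.prems entries[OF n] by (cases "X (Suc n) = 0") auto
    qed
  qed (use step.prems in auto)
qed auto

lemma cell_ex1:
  assumes "u \<ge> 0"
  shows "\<exists>!i. i \<le> q - 2 \<and> u \<in> cell i"
proof (rule ex_ex1I)
  let ?P = "\<lambda>i. i \<le> q - 2 \<and> Y i \<le> X i * u"
  \<comment> \<open>The cell is found as the last one whose lower bound \<open>u\<close> satisfies;
    its upper bound is the failing lower bound of the next index, or void at \<open>q - 2\<close>,
    where \<open>X (Suc i) = 0\<close>.\<close>
  define i where "i = (GREATEST i. ?P i)"
  have "?P 0" using assms by simp
  then have i: "?P i" unfolding i_def by (rule GreatestI_nat[where b = "q - 2"]) auto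
  have "X (Suc i) * u < X i"
  proof (cases "i = q - 2")
    case True
    then have "X (Suc i) = 0" using q_ge_3 by (simp add: Suc_diff_Suc numeral_2_eq_2)
    then show ?thesis using wx_ge_1[of i] i by simp
  next
    case False
    have "\<not> ?P (Suc i)"
      using Greatest_le_nat[of ?P "Suc i" "q - 2"] by (auto simp flip: i_def)
    then show ?thesis using False i by auto
  qed
  with i show "\<exists>i. i \<le> q - 2 \<and> u \<in> cell i" by (auto simp: cell_def)
next
  have *: "\<not> i < j" if "i \<le> q - 2" "j \<le> q - 2" "u \<in> cell i" "u \<in> cell j" for i j
  proof
    assume "i < j"
    moreover have "j < q" using that q_ge_3 by linarith
    ultimately show False
      using cell_bound_mono[of "Suc i" j u] that assms by (auto simp: cell_def)
  qed
  then show "i = j" if "i \<le> q - 2 \<and> u \<in> cell i" "j \<le> q - 2 \<and> u \<in> cell j" for i j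
    using that by (meson linorder_neqE_nat)
qed

lemma branch_0: "branch i 0 = Y i / X i"
  by (simp add: branch_def)

text \<open>\<open>branch j 0\<close> is the left end of \<open>cell j\<close>, and the cells are
  ordered by their index.\<close>

lemma cell_less_iff:
  assumes "j \<le> q - 2" "u \<ge> 0"
  shows "u < branch j 0 \<longleftrightarrow> (\<exists>i<j. u \<in> cell i)"
proof -
  obtain k where k: "k \<le> q - 2" "u \<in> cell k" using cell_ex1[OF assms(2)] by blast
  have lt: "j < q" "k < q" using assms k q_ge_3 by linarith+
  have "u < branch j 0 \<longleftrightarrow> \<not> Y j \<le> X j * u"
    using entries[OF assms(1)] by (auto simp: branch_0 field_simps)
  also have "\<dots> \<longleftrightarrow> k < j"
  proof
    assume "\<not> Y j \<le> X j * u"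
    then show "k < j"
      using cell_bound_mono[of j k u] k assms lt by (force simp: cell_def)
  next
    assume "k < j"
    then show "\<not> Y j \<le> X j * u"
      using cell_bound_mono[of "Suc k" j u] k assms lt by (force simp: cell_def)
  qed
  also have "\<dots> \<longleftrightarrow> (\<exists>i<j. u \<in> cell i)"
    using cell_ex1[OF assms(2)] k assms(1) by (metis le_trans less_imp_le)
  finally show ?thesis .
qed

lemma lambda_ge_1: "hecke_lambda q \<ge> 1"
  using wx_ge_1[of 1] q_ge_3 by (simp add: wx_Suc)

text \<open>The matrix of index \<open>q - 2\<close> is the transpose of \<open>hecke_T q\<close>,
  which acts on slopes as a translation.\<close>

lemma last_branch: "branch (q - 2) u = u + hecke_lambda q"
proof -
  have "Suc (q - 2) = q - 1" "q - 2 - 0 = q - 2" using q_ge_3 by auto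
  then show ?thesis
    using wx_reflect[of 0] wy_reflect[of 0] wx_Suc_reflect[of 0] by (simp add: branch_def wx_Suc)
qed

end

section \<open>Product coordinates and the extension map\<close>

text \<open>For \<open>d = 0\<close> the quotient is infinite and both sides are true, so the
  conventions at infinity need no separate treatment later.\<close>

lemma ereal_less_divide_iff:
  assumes "0 < n" "0 \<le> d"
  shows "ereal s < ereal n / ereal d \<longleftrightarrow> s * d < n"
proof (cases "d = 0")
  case False
  then show ?thesis using assms by (simp add: pos_less_divide_eq)
qed (use assms in \<open>simp add: divide_ereal_def flip: zero_ereal_def\<close>)

lemma ereal_divide_le_iff:
  assumes "0 < d"
  shows "ereal n / ereal d \<le> ereal s \<longleftrightarrow> n \<le> s * d"
  using assms by (simp add: pos_divide_le_eq)

definition ucoord :: "real \<times> real \<Rightarrow> real" where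
  "ucoord = (\<lambda>(a, s). (1 - a) / a)"

definition tcoord :: "real \<times> real \<Rightarrow> real" where
  "tcoord = (\<lambda>(a, s). s * a * a / (1 - s * (a * (1 - a))))"

text \<open>Solves the two coordinates for \<open>(a, s)\<close>; the denominator comes from
  \<open>1 + t * u = 1 / (1 - s * a * (1 - a))\<close>.\<close>

definition of_coords :: "real \<Rightarrow> real \<Rightarrow> real \<times> real" where
  "of_coords u t = (1 / (1 + u), t * (1 + u) * (1 + u) / (1 + t * u))"

lemma S_dom_iff: "(a, s) \<in> S_dom \<longleftrightarrow> 0 < a \<and> a \<le> 1 \<and> 0 \<le> s \<and> s * (a * (1 - a)) < 1"
proof -
  have "0 < a \<Longrightarrow> a \<le> 1 \<Longrightarrow> 0 \<le> a * (1 - a)" by simp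
  then show ?thesis
    using ereal_less_divide_iff[of 1 "a * (1 - a)" s] by (auto simp: S_dom_def one_ereal_def)
qed

lemma ucoord_nonneg: "p \<in> S_dom \<Longrightarrow> ucoord p \<ge> 0"
  by (cases p) (auto simp: S_dom_iff ucoord_def)

lemma tcoord_nonneg: "p \<in> S_dom \<Longrightarrow> tcoord p \<ge> 0"
  by (cases p) (auto simp: S_dom_iff tcoord_def intro!: divide_nonneg_nonneg)

lemma of_coords:
  assumes "u \<ge> 0" "t \<ge> 0"
  shows "of_coords u t \<in> S_dom" "ucoord (of_coords u t) = u" "tcoord (of_coords u t) = t"
proof -
  define d where "d = 1 + t * u"
  have d: "d > 0" using assms by (simp add: d_def add_pos_nonneg)
  have "1 / (1 + u) * (1 - 1 / (1 + u)) = u / ((1 + u) * (1 + u))"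
    using assms by (simp add: field_simps)
  then have eq: "t * (1 + u) * (1 + u) / d * (1 / (1 + u) * (1 - 1 / (1 + u))) = t * u / d"
    using assms by simp
  have "1 - t * u / d = 1 / d" using d by (simp add: d_def field_simps)
  then have "t * u / d < 1" using d by (smt (verit) zero_less_divide_1_iff)
  then show "of_coords u t \<in> S_dom"
    unfolding of_coords_def S_dom_iff d_def[symmetric] eq using assms d by simp
  show "ucoord (of_coords u t) = u"
    using assms by (simp add: ucoord_def of_coords_def field_simps)
  show "tcoord (of_coords u t) = t"
    unfolding tcoord_def of_coords_def d_def[symmetric] prod.case eq \<open>1 - t * u / d = 1 / d\<close>
    using assms d by simp
qed

lemma fst_eq_ucoord: "p \<in> S_dom \<Longrightarrow> fst p = 1 / (1 + ucoord p)"
  by (cases p) (auto simp: S_dom_iff ucoord_def field_simps)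

text \<open>Recovers \<open>s\<close> from \<open>a\<close> and \<open>tcoord\<close>. This
  separates points by their coordinates and later transfers measurability to the second
  component.\<close>

lemma snd_eq_tcoord:
  assumes "(a, s) \<in> S_dom"
  shows "s = tcoord (a, s) / (a * (a + tcoord (a, s) * (1 - a)))"
proof -
  have a: "a > 0" and d: "1 - s * (a * (1 - a)) > 0"
    using assms by (auto simp: S_dom_iff)
  then have "a + tcoord (a, s) * (1 - a) = a / (1 - s * (a * (1 - a)))"
    by (simp add: tcoord_def field_simps)
  then show ?thesis using a d by (simp add: tcoord_def)
qed

lemma coords_eqI:
  assumes "p \<in> S_dom" "p' \<in> S_dom" "ucoord p = ucoord p'" "tcoord p = tcoord p'"
  shows "p = p'"
proof -
  obtain a s a' s' where p: "p = (a, s)" "p' = (a', s')" by fastforce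
  have "a = a'" using assms fst_eq_ucoord[of p] fst_eq_ucoord[of p'] by (simp add: p)
  then show ?thesis
    using assms snd_eq_tcoord[of a s] snd_eq_tcoord[of a' s'] by (simp add: p)
qed

lemma slope_vector: "a > 0 \<Longrightarrow> slope (vector [a, b]) = ereal (b / a)"
  by (simp add: slope_def)

section \<open>The partitions in product coordinates\<close>

context hecke
begin

lemma slope_w: "slope (hecke_w q i) = ereal (Y i) / ereal (X i)" if "i < q"
proof (cases "X i = 0")
  case True
  have "Y i \<noteq> 0" using wx_det[of q i] True by auto
  then have "Y i > 0" using wy_nonneg[of i] that by simp
  moreover have "slope (hecke_w q i) = \<infinity>" using True by (simp add: slope_def wx_def)
  ultimately show ?thesis
    using True by (simp add: divide_ereal_def flip: zero_ereal_def)
qed (auto simp: slope_def wx_def wy_def)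

lemma inverse_one_plus_slope_w:
  assumes "i < q"
  shows "1 / (1 + slope (hecke_w q i)) = ereal (X i / (X i + Y i))"
proof (cases "X i = 0")
  case True
  then show ?thesis by (simp add: slope_def wx_def zero_ereal_def)
next
  case False
  then have "X i + Y i > 0" using wx_nonneg wy_nonneg[of i] assms
    by (metis add_nonneg_eq_0_iff add_nonneg_nonneg less_eq_real_def less_imp_le)
  then have "1 / (1 + Y i / X i) = X i / (X i + Y i)" "1 + Y i / X i \<noteq> 0"
    using False by (auto simp: field_simps)
  then show ?thesis using False by (simp add: slope_def wx_def wy_def one_ereal_def)
qed

lemma index_bounds: "i \<le> q - 2 \<Longrightarrow> i < q" "i \<le> q - 2 \<Longrightarrow> Suc i < q"
  using q_ge_3 by auto

lemma V_set_iff: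
  assumes "i \<le> q - 2"
  shows "p \<in> V_set q i \<longleftrightarrow> p \<in> S_dom \<and> ucoord p \<in> cell i"
proof (cases p)
  case (Pair a s)
  note e = entries[OF assms]
  have "slope (hecke_w q i) \<le> slope (vector [a, 1 - a]) \<longleftrightarrow> Y i \<le> X i * ucoord p"
    "slope (vector [a, 1 - a]) < slope (hecke_w q (Suc i)) \<longleftrightarrow> X (Suc i) * ucoord p < X i"
    if "a > 0"
    unfolding slope_w[OF index_bounds(1)[OF assms]] slope_w[OF index_bounds(2)[OF assms]]
      slope_vector[OF that] wy_Suc
    using e by (subst ereal_divide_le_iff ereal_less_divide_iff; simp add: Pair ucoord_def mult.commute)+
  then show ?thesis by (auto simp: V_set_def Pair S_dom_iff cell_def)
qed

text \<open>\<open>R_fun q i a (1 - a)\<close> is the height \<open>s\<close> at which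
  \<open>tcoord\<close> equals \<open>Y i / X i\<close>. Clearing denominators covers the case where
  the upper bound is infinite.\<close>

lemma H_set_iff:
  assumes "i \<le> q - 2"
  shows "p \<in> H_set q i \<longleftrightarrow> p \<in> S_dom \<and> tcoord p \<in> cell i"
proof (cases p)
  case (Pair a s)
  note e = entries[OF assms]
  have "(R_fun q i a (1 - a) \<le> ereal s \<longleftrightarrow> Y i \<le> X i * tcoord p) \<and>
    (ereal s < R_fun q (Suc i) a (1 - a) \<longleftrightarrow> X (Suc i) * tcoord p < X i)" if "p \<in> S_dom"
  proof -
    have a: "0 < a" "a \<le> 1" and d: "1 - s * (a * (1 - a)) > 0"
      using that by (auto simp: Pair S_dom_iff)
    have "a * (X i * a + Y i * (1 - a)) > 0" "a * (X (Suc i) * a + X i * (1 - a)) \<ge> 0"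
      using a e by (auto intro!: mult_pos_pos mult_nonneg_nonneg add_pos_nonneg add_nonneg_nonneg)
    then have "R_fun q i a (1 - a) \<le> ereal s \<longleftrightarrow> Y i \<le> s * (a * (X i * a + Y i * (1 - a)))"
      "ereal s < R_fun q (Suc i) a (1 - a) \<longleftrightarrow> s * (a * (X (Suc i) * a + X i * (1 - a))) < X i"
      unfolding R_fun_def wy_Suc using e by (subst ereal_divide_le_iff ereal_less_divide_iff; simp)+
    moreover have "Y i \<le> X i * tcoord p \<longleftrightarrow> Y i * (1 - s * (a * (1 - a))) \<le> X i * (s * a * a)"
      "X (Suc i) * tcoord p < X i \<longleftrightarrow> X (Suc i) * (s * a * a) < X i * (1 - s * (a * (1 - a)))"
      using d by (simp_all add: Pair tcoord_def pos_le_divide_eq pos_divide_less_eq)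
    ultimately show ?thesis by (simp add: algebra_simps)
  qed
  then show ?thesis by (auto simp: H_set_def Pair cell_def)
qed

lemma I_set_eq:
  assumes "i \<le> q - 2"
  shows "I_set q i = {X (Suc i) / (X (Suc i) + X i) <.. X i / (X i + Y i)}"
  using index_bounds[OF assms]
  by (auto simp: I_set_def inverse_one_plus_slope_w)

lemma I_set_iff:
  assumes "i \<le> q - 2"
  shows "a \<in> I_set q i \<longleftrightarrow> 0 < a \<and> a \<le> 1 \<and> (1 - a) / a \<in> cell i"
proof -
  note e = entries[OF assms]
  have "X (Suc i) / (X (Suc i) + X i) \<ge> 0" "X i / (X i + Y i) \<le> 1" using e by auto
  moreover have "X (Suc i) / (X (Suc i) + X i) < a \<longleftrightarrow> X (Suc i) * ((1 - a) / a) < X i" if "a > 0"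
    using e that by (simp add: field_simps)
  moreover have "a \<le> X i / (X i + Y i) \<longleftrightarrow> Y i \<le> X i * ((1 - a) / a)" if "a > 0"
    using e that by (simp add: field_simps)
  ultimately show ?thesis unfolding I_set_eq[OF assms] cell_def
    by (smt (verit) greaterThanAtMost_iff mem_Collect_eq)
qed

lemma V_set_iff_fst: "i \<le> q - 2 \<Longrightarrow> p \<in> V_set q i \<longleftrightarrow> p \<in> S_dom \<and> fst p \<in> I_set q i"
  by (cases p) (auto simp: V_set_iff I_set_iff ucoord_def S_dom_iff)

lemma V_set_ex1: "p \<in> S_dom \<Longrightarrow> \<exists>!i. i \<le> q - 2 \<and> p \<in> V_set q i"
  using cell_ex1[OF ucoord_nonneg, of p] V_set_iff by blast

lemma H_set_ex1: "p \<in> S_dom \<Longrightarrow> \<exists>!i. i \<le> q - 2 \<and> p \<in> H_set q i"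
  using cell_ex1[OF tcoord_nonneg, of p] H_set_iff by blast

lemma I_set_ex1:
  assumes "a \<in> {0<..1}"
  shows "\<exists>!i. i \<le> q - 2 \<and> a \<in> I_set q i"
proof -
  have "(a, 0) \<in> S_dom" using assms by (simp add: S_dom_iff)
  then show ?thesis using V_set_ex1 V_set_iff_fst by (metis fst_conv)
qed

section \<open>Explicit solution of the matrix equation\<close>

definition numer :: "nat \<Rightarrow> real \<Rightarrow> real" where
  "numer i a = X i * a - X (Suc i) * (1 - a)"

definition conumer :: "nat \<Rightarrow> real \<Rightarrow> real" where
  "conumer i a = X i * (1 - a) - Y i * a"

lemma rho_eq: "hecke_rho q i a = numer i a + conumer i a"
  by (simp add: hecke_rho_def numer_def conumer_def algebra_simps)

text \<open>On \<open>I_set q i\<close> the vector \<open>(a, 1 - a)\<close> lies in the cone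
  spanned by the columns of \<open>hecke_M q i\<close>, off the ray of the second column;
  \<open>numer\<close> and \<open>conumer\<close> are its coordinates in these columns.\<close>

lemma numer_pos: "i \<le> q - 2 \<Longrightarrow> a \<in> I_set q i \<Longrightarrow> numer i a > 0"
  and conumer_nonneg: "i \<le> q - 2 \<Longrightarrow> a \<in> I_set q i \<Longrightarrow> conumer i a \<ge> 0"
  by (auto simp: I_set_iff cell_def numer_def conumer_def pos_divide_less_eq pos_le_divide_eq)

lemma rho_pos: "i \<le> q - 2 \<Longrightarrow> a \<in> I_set q i \<Longrightarrow> hecke_rho q i a > 0"
  using numer_pos conumer_nonneg rho_eq by (metis add_pos_nonneg)

lemma numer_conumer: "a = X i * numer i a + X (Suc i) * conumer i a"
proof -
  have "X i * numer i a + X (Suc i) * conumer i a = (X i * X i - X (Suc i) * Y i) * a"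
    unfolding numer_def conumer_def by algebra
  then show ?thesis using wx_det[of q i] by simp
qed

lemma inv_M_vector: "matrix_inv (hecke_M q i) *v vector [a, 1 - a] = vector [numer i a, conumer i a]"
  by (simp add: matrix_inv_hecke_M vec_eq_iff forall_2 matrix_vector_mult_def sum_2 numer_def conumer_def)

text \<open>The candidate solution of the matrix equation. On each fiber it is affine with factor
  \<open>(hecke_rho q i a)\<^sup>2\<close>, the fact behind preservation of area.\<close>

definition step :: "nat \<Rightarrow> real \<times> real \<Rightarrow> real \<times> real" where
  "step i = (\<lambda>(a, s). (numer i a / hecke_rho q i a,
     (hecke_rho q i a)\<^sup>2 * s + (hecke_rho q i a)\<^sup>2 * X (Suc i) / (a * numer i a)))"

text \<open>Four entries determine two unknowns: the first row gives \<open>a'\<close>, consistently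
  because \<open>hecke_rho\<close> is the sum of \<open>numer\<close> and \<open>conumer\<close>,
  the lower left entry gives \<open>s'\<close>, and the lower right entry agrees since both sides
  have determinant one.\<close>

lemma Ftilde_rel_iff:
  assumes i: "i \<le> q - 2" and p: "p \<in> V_set q i"
  shows "Ftilde_rel q i p p' \<longleftrightarrow> p' = step i p"
proof -
  obtain a s where [simp]: "p = (a, s)" by fastforce
  obtain a' s' where [simp]: "p' = (a', s')" by fastforce
  define r c d where "r = hecke_rho q i a" and "c = numer i a" and "d = conumer i a"
  have a: "a > 0" "a \<in> I_set q i" using p by (auto simp: V_set_iff_fst[OF i] S_dom_iff)
  have c: "c > 0" and r: "r > 0" and rcd: "r = c + d"
    using numer_pos[OF i a(2)] rho_pos[OF i a(2)] by (simp_all add: c_def r_def d_def rho_eq)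
  have acd: "a = X i * c + X (Suc i) * d" unfolding c_def d_def by (rule numer_conumer)
  have "g_diag (- ln r) ** h_mat s ** g_upper a (1 - a) ** transpose (matrix_inv (hecke_M q i)) =
    vector [vector [c / r, d / r], vector [- r * (s * c + X (Suc i) / a), r * (X i / a - s * d)]]"
    using r a
    by (simp add: g_diag_def h_mat_def g_upper_def matrix_inv_hecke_M vec_eq_iff forall_2
        matrix_matrix_mult_def transpose_def sum_2 exp_minus c_def d_def numer_def conumer_def field_simps)
  moreover have "h_mat s' ** g_upper a' (1 - a') =
    vector [vector [a', 1 - a'], vector [- s' * a', inverse a' - s' * (1 - a')]]"
    by (simp add: h_mat_def g_upper_def vec_eq_iff forall_2 matrix_matrix_mult_def sum_2)
  ultimately have "Ftilde_rel q i p p' \<longleftrightarrow> 0 < a' \<and> a' = c / r \<and> 1 - a' = d / r \<and>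
    s' * a' = r * (s * c + X (Suc i) / a) \<and> inverse a' - s' * (1 - a') = r * (X i / a - s * d)"
    by (auto simp: Ftilde_rel_def vec_eq_iff forall_2 r_def)
  also have "\<dots> \<longleftrightarrow> a' = c / r \<and> s' = r\<^sup>2 * s + r\<^sup>2 * X (Suc i) / (a * c)" (is "?L \<longleftrightarrow> ?R")
  proof
    assume ?L
    then have "s' * (c / r) = r * (s * c + X (Suc i) / a)" by metis
    then have "s' = r * (s * c + X (Suc i) / a) * (r / c)" using c r by (simp add: divide_simps)
    also have "\<dots> = r\<^sup>2 * s + r\<^sup>2 * X (Suc i) / (a * c)"
      using c r a by (simp add: field_simps power2_eq_square)
    finally show ?R using \<open>?L\<close> by simp
  next
    assume R: ?R
    have d_r: "1 - a' = d / r" using R r rcd by (simp add: field_simps)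
    have "inverse a' - s' * (1 - a') = r / c - (r\<^sup>2 * s + r\<^sup>2 * X (Suc i) / (a * c)) * (d / r)"
      unfolding d_r using R by simp
    also have "\<dots> = r / c - r * s * d - r * (X (Suc i) * d) / (a * c)"
      using r c a by (simp add: field_simps power2_eq_square)
    \<comment> \<open>Substituting the expansion of \<open>a\<close> in the columns of
      \<open>hecke_M q i\<close> makes the lower right entries agree.\<close>
    also have "X (Suc i) * d = a - X i * c" using acd by simp
    also have "r / c - r * s * d - r * (a - X i * c) / (a * c) = r * (X i / a - s * d)"
      using r c a by (simp add: field_simps)
    finally have "inverse a' - s' * (1 - a') = r * (X i / a - s * d)" .
    moreover have "s' * a' = r * (s * c + X (Suc i) / a)"
      unfolding conjunct1[OF R] conjunct2[OF R] using r c a by (simp add: field_simps power2_eq_square)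
    moreover have "0 < a'" using R r c by simp
    ultimately show ?L using R d_r by simp
  qed
  also have "\<dots> \<longleftrightarrow> p' = step i p" by (simp add: step_def r_def c_def)
  finally show ?thesis .
qed

lemma Ftilde_eq_step:
  assumes "i \<le> q - 2" "p \<in> V_set q i"
  shows "Ftilde q p = step i p"
proof -
  have "p \<in> S_dom" using assms V_set_iff by blast
  then have "j = i" if "j \<le> q - 2" "p \<in> V_set q j" for j
    using V_set_ex1 assms that by blast
  then have "(\<exists>j\<le>q - 2. p \<in> V_set q j \<and> Ftilde_rel q j p p') \<longleftrightarrow> p' = step i p" for p'
    using Ftilde_rel_iff assms by metis
  then show ?thesis unfolding Ftilde_def by simp
qed

lemma F_map_eq:
  assumes "i \<le> q - 2" "a \<in> I_set q i"
  shows "F_map q a = numer i a / hecke_rho q i a"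
    and "ereal (F_map q a) = 1 / (1 + slope (matrix_inv (hecke_M q i) *v vector [a, 1 - a]))"
proof -
  have *: "1 / (1 + slope (matrix_inv (hecke_M q j) *v vector [a, 1 - a])) =
    ereal (numer j a / hecke_rho q j a)" if "j \<le> q - 2" "a \<in> I_set q j" for j
  proof -
    have "numer j a > 0" "conumer j a \<ge> 0" using numer_pos conumer_nonneg that by auto
    then have "1 + conumer j a / numer j a \<noteq> 0"
      "1 / (1 + conumer j a / numer j a) = numer j a / hecke_rho q j a"
      unfolding rho_eq by (auto simp: field_simps)
    then show ?thesis
      unfolding inv_M_vector slope_vector[OF \<open>numer j a > 0\<close>] by (simp add: one_ereal_def)
  qed
  have "a \<in> {0<..1}" using assms I_set_iff by auto
  then have "j = i" if "j \<le> q - 2" "a \<in> I_set q j" for j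
    using I_set_ex1 assms that by blast
  then have "(\<exists>j\<le>q - 2. a \<in> I_set q j \<and>
     ereal b = 1 / (1 + slope (matrix_inv (hecke_M q j) *v vector [a, 1 - a]))) \<longleftrightarrow>
     b = numer i a / hecke_rho q i a" for b
    using * assms by (metis ereal.inject)
  then show "F_map q a = numer i a / hecke_rho q i a" unfolding F_map_def by simp
  then show "ereal (F_map q a) = 1 / (1 + slope (matrix_inv (hecke_M q i) *v vector [a, 1 - a]))"
    using *[OF assms] by simp
qed

text \<open>In the matrix equation the diagonal factor only rescales rows, so both row slopes
  undergo the Moebius map of the inverse of \<open>hecke_M q i\<close>. For the second row, the sign
  and inversion in \<open>tcoord\<close> turn this into the map of the transpose, that is, of index
  \<open>q - 2 - i\<close>.\<close>

lemma step_coords: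
  assumes i: "i \<le> q - 2" and p: "p \<in> V_set q i"
  shows "step i p \<in> S_dom" (is ?S)
    and "ucoord (step i p) = branch_inv i (ucoord p)" (is ?U)
    and "tcoord (step i p) = branch (q - 2 - i) (tcoord p)" (is ?T)
proof -
  obtain a s where ps: "p = (a, s)" by fastforce
  define r c d where "r = hecke_rho q i a" and "c = numer i a" and "d = conumer i a"
  have a: "a > 0" "a \<le> 1" "a \<in> I_set q i" and s: "s \<ge> 0" and ds: "1 - s * (a * (1 - a)) > 0"
    using p by (auto simp: ps V_set_iff_fst[OF i] S_dom_iff)
  have c: "c > 0" and d: "d \<ge> 0" and r: "r > 0" and rcd: "r = c + d"
    using numer_pos[OF i a(3)] conumer_nonneg[OF i a(3)] rho_pos[OF i a(3)]
    by (simp_all add: c_def r_def d_def rho_eq)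
  have acd: "a = X i * c + X (Suc i) * d" unfolding c_def d_def by (rule numer_conumer)
  note e = entries[OF i]
  define a' s' where "a' = c / r" and "s' = r\<^sup>2 * s + r\<^sup>2 * X (Suc i) / (a * c)"
  have st: "step i p = (a', s')" by (simp add: ps step_def a'_def s'_def r_def c_def)
  have a': "0 < a'" "a' \<le> 1" and b': "1 - a' = d / r"
    using c d r rcd by (auto simp: a'_def field_simps)
  have s'0: "s' \<ge> 0" using e s r c a by (auto simp: s'_def)
  have "s' * (a' * (1 - a')) = s * c * d + (X (Suc i) * d) / a"
    unfolding b' using r c a by (simp add: s'_def a'_def field_simps power2_eq_square)
  also have "X (Suc i) * d = a - X i * c" using acd by simp
  finally have one_minus: "1 - s' * (a' * (1 - a')) = c * (X i - s * a * d) / a"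
    using a by (simp add: field_simps)
  \<comment> \<open>This form shows positivity and is also the denominator of
    \<open>branch (q - 2 - i) (tcoord p)\<close> after scaling.\<close>
  have den: "X i - s * a * d = Y i * (s * a * a) + X i * (1 - s * (a * (1 - a)))"
    by (simp add: d_def conumer_def algebra_simps)
  have "X i * (1 - s * (a * (1 - a))) > 0" "Y i * (s * a * a) \<ge> 0" using e ds a s by auto
  then have den_pos: "X i - s * a * d > 0" unfolding den by linarith
  then have "1 - s' * (a' * (1 - a')) > 0" unfolding one_minus using c a by simp
  then show ?S unfolding st S_dom_iff using a' s'0 by simp
  have "ucoord (step i p) = d / c" unfolding st using b' r c by (simp add: ucoord_def a'_def)
  also have "\<dots> = branch_inv i (ucoord p)"
  proof -
    have "X i * ucoord p - Y i = d / a" "X i - X (Suc i) * ucoord p = c / a"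
      using a by (simp_all add: ps ucoord_def c_def d_def numer_def conumer_def field_simps)
    then show ?thesis using a by (simp add: branch_inv_def)
  qed
  finally show ?U .
  have "tcoord (step i p) = (s' * a' * a') / (c * (X i - s * a * d) / a)"
    unfolding st tcoord_def prod.case one_minus ..
  also have "s' * a' * a' = c * (s * a * c + X (Suc i)) / a"
    using r c a by (simp add: s'_def a'_def field_simps power2_eq_square)
  also have "\<dots> / (c * (X i - s * a * d) / a) = (s * a * c + X (Suc i)) / (X i - s * a * d)"
    using c a by simp
  also have "s * a * c + X (Suc i) = X i * (s * a * a) + X (Suc i) * (1 - s * (a * (1 - a)))"
    by (simp add: c_def numer_def algebra_simps)
  also have "\<dots> / (X i - s * a * d) = branch (q - 2 - i) (tcoord p)"
  proof -
    have "X i * tcoord p + X (Suc i) = 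
        (X i * (s * a * a) + X (Suc i) * (1 - s * (a * (1 - a)))) / (1 - s * (a * (1 - a)))"
      "Y i * tcoord p + X i = (X i - s * a * d) / (1 - s * (a * (1 - a)))"
      unfolding den using ds by (simp_all add: ps tcoord_def add_divide_distrib)
    then show ?thesis
      unfolding branch_def wx_reflect[OF i] wy_reflect[OF i] wx_Suc_reflect[OF i] using ds by simp
  qed
  finally show ?T .
qed

lemma Ftilde_coords:
  assumes "i \<le> q - 2" "p \<in> V_set q i"
  shows "Ftilde q p \<in> S_dom" "ucoord (Ftilde q p) = branch_inv i (ucoord p)"
    "tcoord (Ftilde q p) = branch (q - 2 - i) (tcoord p)"
  using step_coords[OF assms] Ftilde_eq_step[OF assms] by simp_all

text \<open>The map acts like a two-sided shift: a branch is removed from \<open>u\<close> and its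
  mirror image is put in front of \<open>t\<close>.\<close>

lemma Ftilde_of_coords:
  assumes "i \<le> q - 2" "u \<ge> 0" "t \<ge> 0"
  shows "Ftilde q (of_coords (branch i u) t) = of_coords u (branch (q - 2 - i) t)"
proof -
  have b: "branch i u \<in> cell i" "branch i u \<ge> 0" "branch (q - 2 - i) t \<ge> 0"
    using assms by (simp_all add: branch_in_cell branch_nonneg)
  have "of_coords (branch i u) t \<in> V_set q i"
    using assms b by (simp add: V_set_iff of_coords)
  from Ftilde_coords[OF assms(1) this] show ?thesis
    using assms b by (intro coords_eqI) (simp_all add: of_coords branch_inv_branch)
qed

lemma S_dom_cases:
  assumes "p \<in> S_dom"
  obtains i u t where "i \<le> q - 2" "u \<ge> 0" "t \<ge> 0" "p = of_coords (branch i u) t" "p \<in> V_set q i"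
proof -
  obtain i where i: "i \<le> q - 2" "p \<in> V_set q i" using V_set_ex1[OF assms] by blast
  then have u: "ucoord p \<in> cell i" by (simp add: V_set_iff)
  show thesis
  proof (rule that[of i "branch_inv i (ucoord p)" "tcoord p"])
    show "p = of_coords (branch i (branch_inv i (ucoord p))) (tcoord p)"
      using i u assms by (intro coords_eqI) (auto simp: branch_branch_inv of_coords ucoord_nonneg tcoord_nonneg)
  qed (use i u assms in \<open>auto simp: branch_inv_nonneg tcoord_nonneg\<close>)
qed

lemma Ftilde_S_dom: "p \<in> S_dom \<Longrightarrow> Ftilde q p \<in> S_dom"
  using V_set_ex1 Ftilde_coords(1) by blast

section \<open>The swap symmetry and the inverse map\<close>

definition flip :: "real \<times> real \<Rightarrow> real \<times> real" where
  "flip p = of_coords (tcoord p) (ucoord p)"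

lemma flip_of_coords: "u \<ge> 0 \<Longrightarrow> t \<ge> 0 \<Longrightarrow> flip (of_coords u t) = of_coords t u"
  by (simp add: flip_def of_coords)

lemma flip_S_dom: "p \<in> S_dom \<Longrightarrow> flip p \<in> S_dom"
  by (simp add: flip_def of_coords ucoord_nonneg tcoord_nonneg)

lemma flip_flip: "p \<in> S_dom \<Longrightarrow> flip (flip p) = p"
  by (intro coords_eqI) (simp_all add: flip_S_dom flip_def of_coords ucoord_nonneg tcoord_nonneg)

text \<open>Swapping the coordinates turns the shift around, because
  \<open>i \<mapsto> q - 2 - i\<close> is an involution on the indices.\<close>

definition Ftilde_inv :: "real \<times> real \<Rightarrow> real \<times> real" where
  "Ftilde_inv p = flip (Ftilde q (flip p))"

lemma Ftilde_inv_S_dom: "p \<in> S_dom \<Longrightarrow> Ftilde_inv p \<in> S_dom"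
  by (simp add: Ftilde_inv_def flip_S_dom Ftilde_S_dom)

lemma Ftilde_inv_Ftilde:
  assumes "p \<in> S_dom"
  shows "Ftilde_inv (Ftilde q p) = p"
proof -
  obtain i u t where *: "i \<le> q - 2" "u \<ge> 0" "t \<ge> 0" "p = of_coords (branch i u) t"
    using S_dom_cases[OF assms] by metis
  then have "branch i u \<ge> 0" "branch (q - 2 - i) t \<ge> 0"
    by (simp_all add: branch_nonneg)
  then show ?thesis
    using * Ftilde_of_coords[of "q - 2 - i" t u]
    by (simp add: Ftilde_inv_def Ftilde_of_coords flip_of_coords del: diff_diff_left)
qed

lemma Ftilde_Ftilde_inv: "p \<in> S_dom \<Longrightarrow> Ftilde q (Ftilde_inv p) = p"
  using Ftilde_inv_Ftilde[of "flip p"]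
  by (metis Ftilde_S_dom Ftilde_inv_def flip_S_dom flip_flip)

section \<open>Images, the Markov condition and the factor map\<close>

lemma Ftilde_image_iff:
  assumes "A \<subseteq> S_dom"
  shows "p \<in> Ftilde q ` A \<longleftrightarrow> p \<in> S_dom \<and> Ftilde_inv p \<in> A"
proof
  assume "p \<in> Ftilde q ` A"
  then obtain p' where "p' \<in> A" "p = Ftilde q p'" by blast
  then show "p \<in> S_dom \<and> Ftilde_inv p \<in> A"
    using assms Ftilde_S_dom[of p'] Ftilde_inv_Ftilde[of p'] by auto
next
  assume "p \<in> S_dom \<and> Ftilde_inv p \<in> A"
  then show "p \<in> Ftilde q ` A" using Ftilde_Ftilde_inv[of p] by (metis imageI)
qed

text \<open>The forward inclusion holds for every index; the converse follows because the horizontal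
  pieces are disjoint and the index reversal is injective.\<close>

lemma Ftilde_in_H_set_iff:
  assumes i: "i \<le> q - 2" and p: "p \<in> S_dom"
  shows "Ftilde q p \<in> H_set q (q - 2 - i) \<longleftrightarrow> p \<in> V_set q i"
proof -
  have *: "Ftilde q p \<in> H_set q (q - 2 - j)" if "j \<le> q - 2" "p \<in> V_set q j" for j
    using Ftilde_coords[OF that] p by (simp add: H_set_iff branch_in_cell tcoord_nonneg)
  obtain j where j: "j \<le> q - 2" "p \<in> V_set q j" using V_set_ex1[OF p] by blast
  show ?thesis
  proof
    assume "Ftilde q p \<in> H_set q (q - 2 - i)"
    then have "q - 2 - i = q - 2 - j"
      using *[OF j] H_set_ex1[OF Ftilde_S_dom[OF p]] by (metis diff_le_self)
    then have "i = j" using i j by simp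
    then show "p \<in> V_set q i" using j by simp
  qed (use * i in auto)
qed

lemma Ftilde_V_set:
  assumes i: "i \<le> q - 2"
  shows "Ftilde q ` V_set q i = H_set q (q - 2 - i)"
proof (intro set_eqI)
  fix p
  have V: "V_set q i \<subseteq> S_dom" using V_set_iff[OF i] by blast
  have "p \<in> S_dom \<and> Ftilde_inv p \<in> V_set q i \<longleftrightarrow> p \<in> H_set q (q - 2 - i)"
    using Ftilde_in_H_set_iff[OF i] Ftilde_Ftilde_inv Ftilde_inv_S_dom H_set_iff[of "q - 2 - i" p]
    by (metis diff_le_self)
  then show "p \<in> Ftilde q ` V_set q i \<longleftrightarrow> p \<in> H_set q (q - 2 - i)"
    by (simp add: Ftilde_image_iff[OF V])
qed

lemma fst_Ftilde:
  assumes "p \<in> S_dom"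
  shows "fst (Ftilde q p) = F_map q (fst p)"
proof -
  obtain i where i: "i \<le> q - 2" "p \<in> V_set q i" using V_set_ex1[OF assms] by blast
  then have "fst p \<in> I_set q i" by (simp add: V_set_iff_fst)
  then show ?thesis using i by (cases p) (simp add: Ftilde_eq_step step_def F_map_eq(1))
qed

lemma F_map_range: "a \<in> {0<..1} \<Longrightarrow> F_map q a \<in> {0<..1}"
proof -
  assume "a \<in> {0<..1}"
  then have "(a, 0) \<in> S_dom" by (simp add: S_dom_iff)
  moreover obtain a' s' where "Ftilde q (a, 0) = (a', s')" by fastforce
  ultimately show ?thesis
    using fst_Ftilde[of "(a, 0)"] Ftilde_S_dom[of "(a, 0)"] by (simp add: S_dom_iff)
qed


subsection \<open>Density of the orbit of zero under the branches\<close>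

text \<open>A gap is an interval that misses \<open>D\<close>. Pulling it back along a branch gives a gap again, and
  every branch except the translation \<open>branch (q - 2)\<close> is a contraction whose inverse stretches the
  gap by a definite amount.\<close>

lemma gap_expand:
  assumes zero: "0 \<in> D" and branch: "\<And>i e. i \<le> q - 2 \<Longrightarrow> e \<in> D \<Longrightarrow> branch i e \<in> D"
  assumes "0 \<le> t1" "t1 < t2" "{t1..t2} \<inter> D = {}"
  shows "\<exists>r1 r2. 0 \<le> r1 \<and> r1 < r2 \<and> {r1..r2} \<inter> D = {} \<and>
    (t2 - t1) + (t2 - t1)\<^sup>2 \<le> r2 - r1"
  using assms(3-5)
\<comment> \<open>Only the translation calls for recursion, and its inverse lowers the left end by
  at least 1; any other branch gives the gain at once.\<close>
proof (induction "nat \<lfloor>t1\<rfloor>" arbitrary: t1 t2 rule: less_induct)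
  case less
  obtain i where i: "i \<le> q - 2" and t1: "t1 \<in> cell i" using cell_ex1[OF less.prems(1)] by blast
  \<comment> \<open>A gap stays within one cell, since the left end \<open>branch (Suc i) 0\<close>
    of the next cell belongs to \<open>D\<close>.\<close>
  have "t2 \<in> cell i"
  proof (rule ccontr)
    assume "t2 \<notin> cell i"
    moreover have "Y i \<le> X i * t2"
      using t1 entries(1)[OF i] less.prems(2) by (smt (verit) cell_def mem_Collect_eq mult_left_mono)
    ultimately have t2: "X i \<le> X (Suc i) * t2" by (auto simp: cell_def)
    moreover have "i \<noteq> q - 2"
    proof
      assume "i = q - 2"
      then have "Suc i = q - Suc 0" using q_ge_3 by linarith
      then show False using t2 entries(1)[OF i] by simp
    qed
    ultimately have si: "Suc i \<le> q - 2" using i by linarith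
    then have "branch (Suc i) 0 = X i / X (Suc i)" by (simp add: branch_0)
    moreover have "X (Suc i) > 0" using entries(1)[OF si] by simp
    ultimately have "branch (Suc i) 0 \<in> {t1..t2}"
      using t1 t2 by (simp add: cell_def pos_le_divide_eq pos_divide_le_eq mult.commute)
    then show False using branch[OF si zero] less.prems(3) by blast
  qed
  define r1 r2 where "r1 = branch_inv i t1" and "r2 = branch_inv i t2"
  have r: "r1 \<ge> 0" "r2 \<ge> 0" "branch i r1 = t1" "branch i r2 = t2"
    using t1 \<open>t2 \<in> cell i\<close> i by (simp_all add: r1_def r2_def branch_inv_nonneg branch_branch_inv)
  then have "r1 < r2" using branch_less_iff[OF i r(1,2)] less.prems(2) by simp
  have gap: "{r1..r2} \<inter> D = {}"
  proof (rule ccontr)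
    assume "\<not> ?thesis"
    then obtain e where e: "e \<in> D" "r1 \<le> e" "e \<le> r2" by auto
    then have "branch i e \<in> {t1..t2}"
      using branch_less_iff[OF i, of e r1] branch_less_iff[OF i, of r2 e] r by force
    then show False using branch[OF i e(1)] less.prems(3) by blast
  qed
  show ?case
  proof (cases "i = q - 2")
    case True
    then have t: "t1 = r1 + hecke_lambda q" "t2 = r2 + hecke_lambda q" using r last_branch by auto
    then have "r1 \<le> t1 - 1" using lambda_ge_1 by simp
    then have "nat \<lfloor>r1\<rfloor> < nat \<lfloor>t1\<rfloor>" using r(1) by linarith
    from less.hyps[OF this r(1) \<open>r1 < r2\<close> gap] show ?thesis using t by simp
  next
    case False
    then have si: "Suc i \<le> q - 2" using i by simp
    note e = entries(1)[OF i] entries(1)[OF si]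
    have "r2 - r1 = (t2 - t1) * ((X (Suc i) * r1 + X i) * (X (Suc i) * r2 + X i))"
    proof -
      have "X (Suc i) * r1 + X i \<noteq> 0" "X (Suc i) * r2 + X i \<noteq> 0"
        using branch_denom_pos[OF i r(1)] branch_denom_pos[OF i r(2)] by auto
      then show ?thesis using branch_diff[OF i r(1,2)] unfolding r(3,4) by simp
    qed
    \<comment> \<open>One denominator is at least 1 and the other at least \<open>r2 + 1\<close>,
      because \<open>X (Suc i) \<ge> 1\<close> away from the last branch.\<close>
    also have "\<dots> \<ge> (t2 - t1) * (1 * (r2 + 1))"
      using less.prems(2) branch_denom_pos[OF i r(1)] e r(2)
        mult_right_mono[OF e(2) r(2)]
      by (intro mult_left_mono mult_mono) auto
    finally have *: "(t2 - t1) * (r2 + 1) \<le> r2 - r1" by simp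
    have "t2 - t1 \<le> (t2 - t1) * (r2 + 1)" using less.prems(2) r(2) by simp
    \<comment> \<open>Thus \<open>r2 + 1\<close> is at least 1 plus the old length, which produces
      the quadratic gain.\<close>
    then have "t2 - t1 \<le> r2" using * r(1) by linarith
    then have "(t2 - t1) * (1 + (t2 - t1)) \<le> (t2 - t1) * (r2 + 1)"
      using less.prems(2) by (intro mult_left_mono) auto
    then have "(t2 - t1) + (t2 - t1)\<^sup>2 \<le> r2 - r1"
      using * by (simp add: algebra_simps power2_eq_square)
    then show ?thesis using r(1) \<open>r1 < r2\<close> gap by blast
  qed
qed

text \<open>Iterating the last branch from 0 puts all multiples of \<open>hecke_lambda q\<close>
  into \<open>D\<close>, and a closed interval of that length in the half-line contains one.\<close>

lemma gap_bound:
  assumes zero: "0 \<in> D" and branch: "\<And>i e. i \<le> q - 2 \<Longrightarrow> e \<in> D \<Longrightarrow> branch i e \<in> D"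
  assumes "0 \<le> t1" "{t1..t2} \<inter> D = {}"
  shows "t2 - t1 < hecke_lambda q"
proof (rule ccontr)
  assume long: "\<not> ?thesis"
  have D: "real n * hecke_lambda q \<in> D" for n
  proof (induction n)
    case (Suc n)
    then show ?case using branch[OF order_refl Suc] by (simp add: last_branch algebra_simps)
  qed (simp add: zero)
  have l: "hecke_lambda q > 0" using lambda_ge_1 by simp
  define n where "n = nat \<lceil>t1 / hecke_lambda q\<rceil>"
  have "t1 / hecke_lambda q \<le> real n" "real n \<le> t1 / hecke_lambda q + 1"
    using l assms(3) by (simp_all add: n_def)
  then have "t1 \<le> real n * hecke_lambda q" "real n * hecke_lambda q \<le> t1 + hecke_lambda q"
    using l by (simp_all add: field_simps)
  then have "real n * hecke_lambda q \<in> {t1..t2}" using long by simp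
  then show False using D[of n] assms(4) by blast
qed

text \<open>A gap of length \<open>d\<close> could be lengthened by at least
  \<open>d\<^sup>2\<close> any number of times, beyond the bound
  \<open>hecke_lambda q\<close>.\<close>

lemma branch_closed_dense:
  assumes zero: "0 \<in> D" and branch: "\<And>i e. i \<le> q - 2 \<Longrightarrow> e \<in> D \<Longrightarrow> branch i e \<in> D"
  assumes t: "0 \<le> t1" "t1 < t2"
  shows "\<exists>e\<in>D. t1 \<le> e \<and> e \<le> t2"
proof (rule ccontr)
  assume "\<not> ?thesis"
  then have gap: "{t1..t2} \<inter> D = {}" by auto
  define d where "d = t2 - t1"
  have d: "d > 0" using t by (simp add: d_def)
  have ex: "\<exists>r1 r2. 0 \<le> r1 \<and> r1 < r2 \<and> {r1..r2} \<inter> D = {} \<and> d + real n * d\<^sup>2 \<le> r2 - r1" for n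
  proof (induction n)
    case 0
    then show ?case using t gap by (auto simp: d_def)
  next
    case (Suc n)
    then obtain r1 r2 where r: "0 \<le> r1" "r1 < r2" "{r1..r2} \<inter> D = {}" "d + real n * d\<^sup>2 \<le> r2 - r1"
      by blast
    have "d \<le> r2 - r1" using r(4) by (smt (verit) of_nat_0_le_iff zero_le_mult_iff zero_le_power2)
    then have "d\<^sup>2 \<le> (r2 - r1)\<^sup>2" using d by (intro power_mono) auto
    then have "d + real (Suc n) * d\<^sup>2 \<le> (r2 - r1) + (r2 - r1)\<^sup>2"
      using r(4) by (simp add: algebra_simps)
    then show ?case using gap_expand[OF zero branch r(1-3)] by (meson order_trans)
  qed
  obtain n where "hecke_lambda q < real n * d\<^sup>2"
    using reals_Archimedean3[of "d\<^sup>2"] d by auto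
  moreover obtain r1 r2 where "0 \<le> r1" "{r1..r2} \<inter> D = {}" "d + real n * d\<^sup>2 \<le> r2 - r1"
    using ex[of n] by blast
  ultimately show False using gap_bound[OF zero branch, of r1 r2] d by force
qed

end

section \<open>Invariance of the measures\<close>

lemma borel_measurable_fst_real [measurable]: "fst \<in> borel_measurable (borel :: (real \<times> real) measure)"
  and borel_measurable_snd_real [measurable]: "snd \<in> borel_measurable (borel :: (real \<times> real) measure)"
  by (intro borel_measurable_continuous_onI continuous_intros)+

lemma S_dom_eq: "S_dom = {p. 0 < fst p \<and> fst p \<le> 1 \<and> 0 \<le> snd p \<and> snd p * (fst p * (1 - fst p)) < 1}"
  using S_dom_iff by auto

lemma S_dom_measurable [measurable]: "S_dom \<in> sets borel"
  unfolding S_dom_eq by measurable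

lemma ucoord_measurable [measurable]: "ucoord \<in> borel_measurable borel"
  unfolding ucoord_def split_beta' by measurable

lemma tcoord_measurable [measurable]: "tcoord \<in> borel_measurable borel"
  unfolding tcoord_def split_beta' by measurable

lemma sets_S_measure: "sets S_measure = sets (restrict_space borel S_dom)"
  by (simp add: S_measure_def sets_restrict_space)

lemma sets_S_measure_iff: "A \<in> sets S_measure \<longleftrightarrow> A \<in> sets borel \<and> A \<subseteq> S_dom"
  by (simp add: S_measure_def sets_restrict_space_iff conj_commute)

lemma space_S_measure [simp]: "space S_measure = S_dom"
  by (simp add: S_measure_def space_restrict_space)

lemma emeasure_S_measure: "A \<subseteq> S_dom \<Longrightarrow> emeasure S_measure A = emeasure lborel A"
  by (simp add: S_measure_def emeasure_restrict_space)

lemma measurable_S_measure: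
  assumes "f \<in> borel_measurable (restrict_space borel S_dom)" "\<And>p. p \<in> S_dom \<Longrightarrow> f p \<in> S_dom"
  shows "f \<in> measurable S_measure S_measure"
proof -
  have "f \<in> measurable (restrict_space borel S_dom) (restrict_space borel S_dom)"
    using assms by (intro measurable_restrict_space2) (auto simp: space_restrict_space)
  then show ?thesis
    by (subst measurable_cong_sets[OF sets_S_measure sets_S_measure])
qed

lemma emeasure_lborel_eq_fibers:
  assumes "A \<in> sets (borel :: (real \<times> real) measure)"
  shows "emeasure lborel A = (\<integral>\<^sup>+a. emeasure lborel {s. (a, s) \<in> A} \<partial>lborel)"
proof -
  have "A \<in> sets (lborel \<Otimes>\<^sub>M lborel)" using assms unfolding lborel_prod by simp
  from lborel.emeasure_pair_measure_alt[OF this] show ?thesis unfolding lborel_prod by (simp add: vimage_def)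
qed

lemma measurable_emeasure_fiber:
  assumes "A \<in> sets (borel :: (real \<times> real) measure)"
  shows "(\<lambda>a. emeasure lborel {s. (a, s) \<in> A}) \<in> borel_measurable borel"
proof -
  have "A \<in> sets (lborel \<Otimes>\<^sub>M lborel)" using assms unfolding lborel_prod by simp
  from lborel.measurable_emeasure_Pair[OF this] show ?thesis by (simp add: vimage_def)
qed

lemma emeasure_lborel_affine_vimage:
  fixes c k :: real
  assumes "c > 0" "B \<in> sets borel"
  shows "emeasure lborel {s. k + c * s \<in> B} = ennreal (1 / c) * emeasure lborel B"
proof -
  have "emeasure lborel B = (\<integral>\<^sup>+s. indicator B s \<partial>lborel)" using assms by simp
  also have "\<dots> = ennreal c * (\<integral>\<^sup>+s. indicator B (k + c * s) \<partial>lborel)"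
    using assms nn_integral_real_affine[of "indicator B" c k] by simp
  also have "(\<lambda>s. indicator B (k + c * s) :: ennreal) = indicator {s. k + c * s \<in> B}"
    by (auto simp: indicator_def)
  also have "(\<integral>\<^sup>+s. indicator {s. k + c * s \<in> B} s \<partial>lborel) = emeasure lborel {s. k + c * s \<in> B}"
  proof -
    have "(\<lambda>s. k + c * s) -` B \<inter> space borel \<in> sets borel"
      using assms by (intro measurable_sets[of _ borel borel]) auto
    then show ?thesis by (simp add: vimage_def)
  qed
  finally show ?thesis
    using assms by (simp add: mult.assoc[symmetric] ennreal_mult'[symmetric])
qed

section \<open>Measurability of the pieces and of the maps\<close>

context hecke
begin

lemma V_set_measurable [measurable]: "i \<le> q - 2 \<Longrightarrow> V_set q i \<in> sets borel"
proof -
  assume "i \<le> q - 2"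
  then have "V_set q i = S_dom \<inter> {p. Y i \<le> X i * ucoord p \<and> X (Suc i) * ucoord p < X i}"
    by (auto simp: V_set_iff cell_def)
  then show ?thesis by simp
qed

lemma H_set_measurable [measurable]: "i \<le> q - 2 \<Longrightarrow> H_set q i \<in> sets borel"
proof -
  assume "i \<le> q - 2"
  then have "H_set q i = S_dom \<inter> {p. Y i \<le> X i * tcoord p \<and> X (Suc i) * tcoord p < X i}"
    by (auto simp: H_set_iff cell_def)
  then show ?thesis by simp
qed

lemma step_measurable [measurable]: "step i \<in> borel_measurable borel"
  unfolding step_def split_beta' numer_def hecke_rho_def by measurable

lemma Ftilde_measurable: "Ftilde q \<in> measurable S_measure S_measure"
proof (rule measurable_S_measure)
  let ?R = "restrict_space borel S_dom"
  show "Ftilde q \<in> borel_measurable ?R"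
  proof (rule measurable_piecewise_restrict[where C = "V_set q ` {..q - 2}"])
    show "space ?R \<subseteq> \<Union> (V_set q ` {..q - 2})"
      using V_set_ex1 by (fastforce simp: space_restrict_space)
    fix V assume "V \<in> V_set q ` {..q - 2}"
    then obtain i where i: "i \<le> q - 2" and V: "V = V_set q i" by auto
    show "V \<inter> space ?R \<in> sets ?R"
      using V_set_measurable[OF i] by (simp add: V space_restrict_space sets_restrict_space_iff)
    have "step i \<in> borel_measurable (restrict_space ?R V)"
      by (intro measurable_restrict_space1) measurable
    moreover have "Ftilde q p = step i p" if "p \<in> space (restrict_space ?R V)" for p
      using that Ftilde_eq_step[OF i] by (simp add: V space_restrict_space)
    ultimately show "Ftilde q \<in> borel_measurable (restrict_space ?R V)"
      by (simp cong: measurable_cong)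
  qed auto
qed (rule Ftilde_S_dom)

lemma flip_measurable: "flip \<in> measurable S_measure S_measure"
proof (rule measurable_S_measure)
  have "flip \<in> borel_measurable borel" unfolding flip_def of_coords_def by measurable
  then show "flip \<in> borel_measurable (restrict_space borel S_dom)" by (rule measurable_restrict_space1)
qed (rule flip_S_dom)

lemma Ftilde_inv_measurable: "Ftilde_inv \<in> measurable S_measure S_measure"
  unfolding Ftilde_inv_def
  by (intro measurable_compose[OF flip_measurable] measurable_compose[OF Ftilde_measurable] flip_measurable)

section \<open>Area on one vertical piece\<close>

lemma conumer_numer: "1 - a = Y i * numer i a + X i * conumer i a"
proof -
  have "Y i * numer i a + X i * conumer i a = (X i * X i - X (Suc i) * Y i) * (1 - a)"
    unfolding numer_def conumer_def by algebra
  then show ?thesis using wx_det[of q i] by simp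
qed

text \<open>The value \<open>z\<close> fixes the direction of \<open>(numer, conumer)\<close>.
  Applying \<open>hecke_M q i\<close> and adding coordinates gives 1, which fixes the scale
  \<open>hecke_rho\<close> and then \<open>a\<close>.\<close>

lemma numer_over_rho_inj:
  assumes "i \<le> q - 2" "a \<in> I_set q i" "b \<in> I_set q i"
    and eq: "numer i a / hecke_rho q i a = numer i b / hecke_rho q i b"
  shows "a = b"
proof -
  define z where "z = numer i b / hecke_rho q i b"
  have z: "numer i c = z * hecke_rho q i c" "conumer i c = (1 - z) * hecke_rho q i c"
    if "c \<in> {a, b}" for c
  proof -
    have r: "hecke_rho q i c > 0" using rho_pos assms that by blast
    moreover have "z = numer i c / hecke_rho q i c" using that eq by (auto simp: z_def)
    ultimately show "numer i c = z * hecke_rho q i c" by simp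
    then show "conumer i c = (1 - z) * hecke_rho q i c"
      using rho_eq[of i c] by (simp add: algebra_simps)
  qed
  have *: "c = (X i * z + X (Suc i) * (1 - z)) * hecke_rho q i c"
    "1 = (X i * z + X (Suc i) * (1 - z) + Y i * z + X i * (1 - z)) * hecke_rho q i c"
    if "c \<in> {a, b}" for c
    using numer_conumer[of c i] conumer_numer[of c i] unfolding z[OF that] 
    by (auto simp: algebra_simps)
  have "hecke_rho q i a = hecke_rho q i b"
    using *(2)[of a] *(2)[of b] by (metis insertCI mult_cancel_left mult_zero_left zero_neq_one)
  then show ?thesis using *(1)[of a] *(1)[of b] by simp
qed

text \<open>The numerator of the quotient rule collapses to the determinant.\<close>

lemma numer_over_rho_deriv:
  assumes "hecke_rho q i a \<noteq> 0"
  shows "((\<lambda>a. numer i a / hecke_rho q i a) has_real_derivative 1 / (hecke_rho q i a)\<^sup>2) (at a)"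
proof -
  have "(numer i has_real_derivative (X i + X (Suc i))) (at a)"
    unfolding numer_def by (auto intro!: derivative_eq_intros)
  moreover have "(hecke_rho q i has_real_derivative (X (Suc i) - Y i)) (at a)"
    unfolding hecke_rho_def by (auto intro!: derivative_eq_intros)
  ultimately have "((\<lambda>a. numer i a / hecke_rho q i a) has_real_derivative
      ((X i + X (Suc i)) * hecke_rho q i a - numer i a * (X (Suc i) - Y i)) /
      (hecke_rho q i a * hecke_rho q i a)) (at a)"
    using assms by (rule DERIV_divide)
  also have "(X i + X (Suc i)) * hecke_rho q i a - numer i a * (X (Suc i) - Y i) =
      X i * X i - X (Suc i) * Y i"
    unfolding rho_eq numer_def conumer_def by algebra
  finally show ?thesis using wx_det[of q i] by (simp add: power2_eq_square)
qed

text \<open>Change of variables along one increasing branch of the interval map, which takes the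
  closure of \<open>I_set q i\<close> onto \<open>{0..1}\<close>; the added left endpoint is a null
  set.\<close>

lemma nn_integral_F_branch:
  assumes i: "i \<le> q - 2" and h: "h \<in> borel_measurable borel"
  shows "(\<integral>\<^sup>+a. h a * indicator {0..1} a \<partial>lborel) =
    (\<integral>\<^sup>+a. h (numer i a / hecke_rho q i a) * ennreal (1 / (hecke_rho q i a)\<^sup>2) *
       indicator (I_set q i) a \<partial>lborel)"
proof -
  define l r where "l = X (Suc i) / (X (Suc i) + X i)" and "r = X i / (X i + Y i)"
  note e = entries[OF i]
  have I: "I_set q i = {l<..r}" by (simp add: I_set_eq[OF i] l_def r_def)
  have l: "numer i l = 0" using e by (simp add: l_def numer_def field_simps)
  have r: "conumer i r = 0" using e by (simp add: r_def conumer_def field_simps)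
  have "X i * (X i + X (Suc i)) > X (Suc i) * (X i + Y i)"
    using e by (simp add: algebra_simps)
  then have lr: "l < r" using e by (simp add: l_def r_def divide_less_eq less_divide_eq mult.commute add.commute)
  \<comment> \<open>The substitution works on the closed interval, so positivity is also checked at
    \<open>l\<close>, where \<open>numer\<close> vanishes.\<close>
  have rho: "hecke_rho q i a > 0" if "a \<in> {l..r}" for a
  proof (cases "a = l")
    case True
    have "l * (X (Suc i) + X i) = X (Suc i)" using e by (simp add: l_def)
    moreover have "hecke_rho q i l * (X (Suc i) + X i) =
        X i * (X (Suc i) + X i) - (X i + Y i) * (l * (X (Suc i) + X i))"
      unfolding rho_eq l conumer_def by algebra
    ultimately have "hecke_rho q i l * (X (Suc i) + X i) = X i * X i - X (Suc i) * Y i"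
      by (simp add: algebra_simps)
    then have "hecke_rho q i l * (X (Suc i) + X i) > 0" using e by simp
    then show ?thesis using e True by (simp add: zero_less_mult_iff)
  next
    case False
    then show ?thesis using that rho_pos[OF i, of a] by (simp add: I)
  qed
  let ?G = "\<lambda>a. numer i a / hecke_rho q i a"
  have ends: "?G l = 0" "?G r = 1" using l r rho[of r] lr rho_eq[of i r] by auto
  have "(\<integral>\<^sup>+a. h a * indicator {0..1} a \<partial>lborel) = (\<integral>\<^sup>+a. h a * indicator {?G l..?G r} a \<partial>lborel)"
    by (simp only: ends)
  also have "\<dots> = (\<integral>\<^sup>+a. h (?G a) * ennreal (1 / (hecke_rho q i a)\<^sup>2) * indicator {l..r} a \<partial>lborel)"
  proof (rule nn_integral_substitution_aux[OF h _ _ _ _ lr])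
    show "(?G has_real_derivative 1 / (hecke_rho q i a)\<^sup>2) (at a)" if "a \<in> {l..r}" for a
      using rho[OF that] by (intro numer_over_rho_deriv) simp
    have "continuous_on {l..r} (hecke_rho q i)" unfolding hecke_rho_def by (intro continuous_intros)
    then show "continuous_on {l..r} (\<lambda>a. 1 / (hecke_rho q i a)\<^sup>2)"
      using rho by (intro continuous_intros) force+
  qed auto
  also have "\<dots> = (\<integral>\<^sup>+a. h (?G a) * ennreal (1 / (hecke_rho q i a)\<^sup>2) * indicator (I_set q i) a \<partial>lborel)"
  proof (rule nn_integral_cong_AE)
    show "AE a in lborel. h (?G a) * ennreal (1 / (hecke_rho q i a)\<^sup>2) * indicator {l..r} a =
      h (?G a) * ennreal (1 / (hecke_rho q i a)\<^sup>2) * indicator (I_set q i) a"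
      using AE_lborel_singleton[of l] by eventually_elim (auto simp: I indicator_def)
  qed
  finally show ?thesis .
qed

text \<open>Pulling back a fiber divides its length by the square of \<open>hecke_rho\<close>, and
  the derivative of the interval map contributes exactly this factor in the substitution.\<close>

lemma emeasure_Ftilde_vimage_strip:
  assumes i: "i \<le> q - 2" and E: "E \<in> sets borel" "E \<subseteq> H_set q (q - 2 - i)"
  shows "emeasure lborel {p \<in> V_set q i. Ftilde q p \<in> E} = emeasure lborel E"
proof -
  let ?W = "{p \<in> V_set q i. Ftilde q p \<in> E}"
  let ?h = "\<lambda>a. emeasure lborel {s. (a, s) \<in> E}"
  let ?G = "\<lambda>a. numer i a / hecke_rho q i a"
  have "?W = V_set q i \<inter> (step i -` E \<inter> space borel)" using Ftilde_eq_step[OF i] by auto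
  then have W: "?W \<in> sets borel"
    using V_set_measurable[OF i] measurable_sets[OF step_measurable E(1)] by (metis sets.Int)
  have ES: "E \<subseteq> S_dom" using E(2) H_set_iff[of "q - 2 - i"] by auto
  have fiber: "emeasure lborel {s. (a, s) \<in> ?W} =
    ?h (?G a) * ennreal (1 / (hecke_rho q i a)\<^sup>2) * indicator (I_set q i) a" for a
  proof (cases "a \<in> I_set q i")
    case False
    then have empty: "{s. (a, s) \<in> ?W} = {}" by (auto simp: V_set_iff_fst[OF i])
    show ?thesis unfolding empty using False by simp
  next
    case a: True
    define r k where "r = (hecke_rho q i a)\<^sup>2" and
      "k = (hecke_rho q i a)\<^sup>2 * X (Suc i) / (a * numer i a)"
    have r: "r > 0" using rho_pos[OF i a] by (simp add: r_def)
    have step: "step i (a, s) = (?G a, k + r * s)" for s by (simp add: step_def r_def k_def)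
    \<comment> \<open>Since \<open>E\<close> lies in the image of the vertical piece, the point has
      a preimage there; injectivity in \<open>a\<close> and on the fiber identifies it with
      \<open>(a, s)\<close>.\<close>
    have "(a, s) \<in> ?W" if s: "(?G a, k + r * s) \<in> E" for s
    proof -
      have "(?G a, k + r * s) \<in> Ftilde q ` V_set q i" using E(2) s Ftilde_V_set[OF i] by auto
      then obtain p where p: "p \<in> V_set q i" "Ftilde q p = (?G a, k + r * s)" by (metis imageE)
      then have st: "step i p = (?G a, k + r * s)" using Ftilde_eq_step[OF i] by simp
      have "fst p \<in> I_set q i" using p(1) by (simp add: V_set_iff_fst[OF i])
      moreover have "?G (fst p) = ?G a" using st by (simp add: step_def split_beta')
      ultimately have "fst p = a" using numer_over_rho_inj[OF i] a by blast
      then have "p = (a, s)" using st step[of "snd p"] r by (metis Pair_inject add_left_cancel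
            mult_cancel_left order_less_irrefl prod.collapse)
      then show ?thesis using p s by simp
    qed
    then have eq: "{s. (a, s) \<in> ?W} = {s. k + r * s \<in> {s. (?G a, s) \<in> E}}"
      using Ftilde_eq_step[OF i] step by auto
    have "{s. (?G a, s) \<in> E} \<in> sets borel"
    proof -
      have "(\<lambda>s. (?G a, s)) -` E \<inter> space borel \<in> sets borel"
        by (rule measurable_sets[OF _ E(1)]) measurable
      then show ?thesis by (simp add: vimage_def)
    qed
    from emeasure_lborel_affine_vimage[OF r this, of k] show ?thesis
      unfolding eq using a by (simp add: r_def mult.commute)
  qed
  have "?h a * indicator {0..1} a = ?h a" for a
  proof (cases "a \<in> {0..1}")
    case False
    then have "{s. (a, s) \<in> E} = {}" using ES by (auto simp: S_dom_iff subset_eq)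
    then show ?thesis by simp
  qed simp
  then have "emeasure lborel E = (\<integral>\<^sup>+a. ?h a * indicator {0..1} a \<partial>lborel)"
    by (simp add: emeasure_lborel_eq_fibers[OF E(1)])
  also have "\<dots> = (\<integral>\<^sup>+a. emeasure lborel {s. (a, s) \<in> ?W} \<partial>lborel)"
    unfolding nn_integral_F_branch[OF i measurable_emeasure_fiber[OF E(1)]] fiber ..
  also have "\<dots> = emeasure lborel ?W" by (rule emeasure_lborel_eq_fibers[OF W, symmetric])
  finally show ?thesis ..
qed

text \<open>Cut \<open>E\<close> along the horizontal pieces: by the Markov condition each part
  pulls back into a single vertical piece, and reversing the index permutes the sum.\<close>

lemma Ftilde_measure_preserving: "measure_preserving_map S_measure (Ftilde q)"
  unfolding measure_preserving_map_def
proof (intro conjI measure_eqI)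
  show "Ftilde q \<in> measurable S_measure S_measure" by (rule Ftilde_measurable)
  fix E assume "E \<in> sets (distr S_measure S_measure (Ftilde q))"
  then have E': "E \<in> sets S_measure" by simp
  then have E: "E \<in> sets borel" "E \<subseteq> S_dom" by (simp_all add: sets_S_measure_iff)
  let ?H = "\<lambda>j. E \<inter> H_set q j"
  let ?W = "\<lambda>i. {p \<in> V_set q i. Ftilde q p \<in> ?H (q - 2 - i)}"
  have H: "?H j \<in> sets borel" if "j \<le> q - 2" for j
    using E(1) H_set_measurable[OF that] by auto
  have W: "?W i \<in> sets borel" if "i \<le> q - 2" for i
  proof -
    have "?W i = V_set q i \<inter> (step i -` ?H (q - 2 - i) \<inter> space borel)"
      using Ftilde_eq_step[OF that] by auto
    then show ?thesis
      using V_set_measurable[OF that] measurable_sets[OF step_measurable H] by (metis diff_le_self sets.Int)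
  qed
  have V: "V_set q i \<subseteq> S_dom" if "i \<le> q - 2" for i using V_set_iff[OF that] by auto
  have "Ftilde q -` E \<inter> S_dom = (\<Union>i\<in>{..q - 2}. ?W i)"
  proof (intro equalityI subsetI)
    fix p assume p: "p \<in> Ftilde q -` E \<inter> S_dom"
    then obtain i where "i \<le> q - 2" "p \<in> V_set q i" using V_set_ex1 by blast
    then show "p \<in> (\<Union>i\<in>{..q - 2}. ?W i)" using p Ftilde_in_H_set_iff by auto
  qed (use V in auto)
  moreover have "emeasure (distr S_measure S_measure (Ftilde q)) E = emeasure lborel (Ftilde q -` E \<inter> S_dom)"
    using Ftilde_measurable E' by (simp add: emeasure_distr emeasure_S_measure)
  ultimately have "emeasure (distr S_measure S_measure (Ftilde q)) E = emeasure lborel (\<Union>i\<in>{..q - 2}. ?W i)"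
    by (simp only:)
  also have "\<dots> = (\<Sum>i\<le>q - 2. emeasure lborel (?W i))"
  proof (rule sum_emeasure[symmetric])
    show "disjoint_family_on ?W {..q - 2}"
      using V_set_ex1 V by (fastforce simp: disjoint_family_on_def)
  qed (use W in auto)
  also have "\<dots> = (\<Sum>i\<le>q - 2. emeasure lborel (?H (q - 2 - i)))"
    using H by (intro sum.cong emeasure_Ftilde_vimage_strip) auto
  also have "\<dots> = (\<Sum>j\<le>q - 2. emeasure lborel (?H j))"
    by (rule sum.reindex_bij_witness[of _ "\<lambda>j. q - 2 - j" "\<lambda>i. q - 2 - i"]) auto
  also have "\<dots> = emeasure lborel (\<Union>j\<in>{..q - 2}. ?H j)"
  proof (rule sum_emeasure)
    show "disjoint_family_on ?H {..q - 2}"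
      using H_set_ex1 E(2) by (fastforce simp: disjoint_family_on_def)
  qed (use H in auto)
  also have "(\<Union>j\<in>{..q - 2}. ?H j) = E" using H_set_ex1 E(2) by fastforce
  finally show "emeasure (distr S_measure S_measure (Ftilde q)) E = emeasure S_measure E"
    using E(2) by (simp add: emeasure_S_measure)
qed simp

lemma Ftilde_essentially_invertible: "essentially_invertible S_measure (Ftilde q)"
  unfolding essentially_invertible_def
  using Ftilde_inv_measurable by (auto intro!: bexI[of _ Ftilde_inv] simp: Ftilde_inv_Ftilde Ftilde_Ftilde_inv)

end

section \<open>The factor measure\<close>

lemma fiber_length_eq:
  assumes "0 < a" "a < 1"
  shows "emeasure lborel {s. (a, s) \<in> S_dom} = ennreal (1 / (a * (1 - a)))"
proof -
  have "a * (1 - a) > 0" using assms by simp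
  then have "{s. (a, s) \<in> S_dom} = {0..<1 / (a * (1 - a))}"
    using assms by (auto simp: S_dom_iff pos_less_divide_eq)
  then show ?thesis using \<open>a * (1 - a) > 0\<close> by simp
qed

text \<open>The densities differ only at \<open>a = 1\<close>, where the real quotient
  \<open>1 / 0\<close> is 0 but the fiber has infinite length; a single point is a null set.\<close>

lemma mu_F_eq: "mu_F = density (restrict_space lborel {0<..1}) (\<lambda>a. emeasure lborel {s. (a, s) \<in> S_dom})"
  unfolding mu_F_def
proof (rule density_cong)
  let ?R = "restrict_space lborel {0<..1} :: real measure"
  show "(\<lambda>a. ennreal (1 / (a * (1 - a)))) \<in> borel_measurable ?R"
    by (intro measurable_restrict_space1) measurable
  show "(\<lambda>a. emeasure lborel {s. (a, s) \<in> S_dom}) \<in> borel_measurable ?R"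
    using measurable_emeasure_fiber[OF S_dom_measurable] by (intro measurable_restrict_space1) simp
  have "AE a in lborel. a \<in> {0<..1} \<longrightarrow> ennreal (1 / (a * (1 - a))) = emeasure lborel {s. (a, s) \<in> S_dom}"
    using AE_lborel_singleton[of 1] by eventually_elim (auto simp: fiber_length_eq)
  then show "AE a in ?R. ennreal (1 / (a * (1 - a))) = emeasure lborel {s. (a, s) \<in> S_dom}"
    by (subst AE_restrict_space_iff) auto
qed

lemma sets_mu_F: "sets mu_F = sets (restrict_space borel {0<..1})"
  by (simp add: mu_F_def sets_restrict_space)

lemma sets_mu_F_iff: "A \<in> sets mu_F \<longleftrightarrow> A \<in> sets borel \<and> A \<subseteq> {0<..1}"
  by (simp add: mu_F_def sets_restrict_space_iff conj_commute)

lemma space_mu_F [simp]: "space mu_F = {0<..1}"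
  by (simp add: mu_F_def space_restrict_space)

lemma fst_measurable_mu_F: "fst \<in> measurable S_measure mu_F"
proof -
  have "fst \<in> measurable (restrict_space borel S_dom) (restrict_space borel {0<..1})"
    by (intro measurable_restrict_space2 measurable_restrict_space1)
       (auto simp: space_restrict_space S_dom_eq)
  then show ?thesis by (subst measurable_cong_sets[OF sets_S_measure sets_mu_F])
qed

lemma distr_fst_S_measure: "distr S_measure mu_F fst = mu_F"
proof (rule measure_eqI)
  fix A assume "A \<in> sets (distr S_measure mu_F fst)"
  then have A': "A \<in> sets mu_F" by simp
  then have A: "A \<in> sets borel" "A \<subseteq> {0<..1}" by (auto simp: sets_mu_F_iff)
  let ?h = "\<lambda>a. emeasure lborel {s. (a, s) \<in> S_dom}"
  let ?W = "fst -` A \<inter> S_dom"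
  have "?W \<in> sets S_measure" using measurable_sets[OF fst_measurable_mu_F A'] by simp
  then have W: "?W \<in> sets borel" by (simp add: sets_S_measure_iff)
  have fiber: "emeasure lborel {s. (a, s) \<in> ?W} = ?h a * indicator A a" for a
    by (cases "a \<in> A") auto
  have "emeasure (distr S_measure mu_F fst) A = emeasure lborel ?W"
    using fst_measurable_mu_F A' by (simp add: emeasure_distr emeasure_S_measure)
  also have "\<dots> = (\<integral>\<^sup>+a. ?h a * indicator A a \<partial>lborel)"
    unfolding emeasure_lborel_eq_fibers[OF W] fiber ..
  also have "\<dots> = (\<integral>\<^sup>+a. ?h a * indicator A a * indicator {0<..1} a \<partial>lborel)"
    using A(2) by (intro nn_integral_cong) (auto simp: indicator_def)
  also have "\<dots> = (\<integral>\<^sup>+a. ?h a * indicator A a \<partial>restrict_space lborel {0<..1})"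
    by (subst nn_integral_restrict_space) auto
  also have "\<dots> = emeasure mu_F A"
    unfolding mu_F_eq
  proof (rule emeasure_density[symmetric])
    show "?h \<in> borel_measurable (restrict_space lborel {0<..1})"
      using measurable_emeasure_fiber[OF S_dom_measurable] by (intro measurable_restrict_space1) simp
    show "A \<in> sets (restrict_space lborel {0<..1})" using A by (simp add: sets_restrict_space_iff)
  qed
  finally show "emeasure (distr S_measure mu_F fst) A = emeasure mu_F A" .
qed simp

lemma equal_mod_null_refl: "equal_mod_null N \<A> \<A>"
proof -
  have "\<exists>B\<in>\<A>. (A - B) \<union> (B - A) \<in> null_sets (completion N)" if "A \<in> \<A>" for A
    using that by (intro bexI[of _ A]) simp_all
  moreover have "\<exists>B\<in>\<A>. (B - A) \<union> (A - B) \<in> null_sets (completion N)" if "A \<in> \<A>" for A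
    using that by (intro bexI[of _ A]) simp_all
  ultimately show ?thesis unfolding equal_mod_null_def by simp
qed

context hecke
begin

text \<open>The interval map is read off the extension along the section
  \<open>s = 0\<close>.\<close>

lemma F_map_measurable: "F_map q \<in> measurable mu_F mu_F"
proof -
  have "(\<lambda>a::real. (a, 0::real)) \<in> measurable (restrict_space borel {0<..1}) (restrict_space borel S_dom)"
    by (intro measurable_restrict_space2 measurable_restrict_space1)
       (auto simp: space_restrict_space S_dom_iff)
  then have "(\<lambda>a. (a, 0)) \<in> measurable mu_F S_measure"
    by (subst measurable_cong_sets[OF sets_mu_F sets_S_measure])
  then have "(\<lambda>a. fst (Ftilde q (a, 0))) \<in> measurable mu_F mu_F"
    by (intro measurable_compose[OF _ fst_measurable_mu_F] measurable_compose[OF _ Ftilde_measurable])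
  moreover have "(\<lambda>a. fst (Ftilde q (a, 0))) \<in> measurable mu_F mu_F \<longleftrightarrow> F_map q \<in> measurable mu_F mu_F"
    by (rule measurable_cong) (simp add: fst_Ftilde S_dom_iff)
  ultimately show ?thesis by simp
qed

text \<open>Invariance descends from the extension along the semiconjugacy
  \<open>fst\<close>.\<close>

lemma F_map_measure_preserving: "measure_preserving_map mu_F (F_map q)"
  unfolding measure_preserving_map_def
proof
  have "distr mu_F mu_F (F_map q) = distr (distr S_measure mu_F fst) mu_F (F_map q)"
    by (simp add: distr_fst_S_measure)
  also have "\<dots> = distr S_measure mu_F (F_map q \<circ> fst)"
    by (rule distr_distr[OF F_map_measurable fst_measurable_mu_F])
  also have "\<dots> = distr S_measure mu_F (fst \<circ> Ftilde q)"
    by (rule distr_cong) (simp_all add: fst_Ftilde)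
  also have "\<dots> = distr (distr S_measure S_measure (Ftilde q)) mu_F fst"
    by (rule distr_distr[OF fst_measurable_mu_F Ftilde_measurable, symmetric])
  also have "\<dots> = mu_F"
    using Ftilde_measure_preserving by (simp add: measure_preserving_map_def distr_fst_S_measure)
  finally show "distr mu_F mu_F (F_map q) = mu_F" .
qed (rule F_map_measurable)

subsection \<open>Generation of the Borel sets\<close>

abbreviation generators :: "(real \<times> real) set set" where
  "generators \<equiv> \<Union>n. {(Ftilde q ^^ n) ` (fst -` B \<inter> space S_measure) | B. B \<in> sets mu_F}"

abbreviation \<G> where "\<G> \<equiv> forward_generated S_measure (Ftilde q) mu_F fst"

text \<open>Forward images are preimages under the measurable inverse.\<close>

lemma Ftilde_image_sets:
  assumes "A \<in> sets S_measure"
  shows "Ftilde q ` A \<in> sets S_measure"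
proof -
  have "Ftilde q ` A = Ftilde_inv -` A \<inter> S_dom"
    using Ftilde_image_iff[of A] assms by (auto simp: sets_S_measure_iff)
  then show ?thesis using measurable_sets[OF Ftilde_inv_measurable assms] by simp
qed

lemma generators_subset: "generators \<subseteq> sets S_measure"
proof -
  have "(Ftilde q ^^ n) ` (fst -` B \<inter> S_dom) \<in> sets S_measure" if "B \<in> sets mu_F" for n B
  proof (induction n)
    case 0
    then show ?case using measurable_sets[OF fst_measurable_mu_F that] by simp
  next
    case (Suc n)
    have "(Ftilde q ^^ Suc n) ` (fst -` B \<inter> S_dom) = Ftilde q ` (Ftilde q ^^ n) ` (fst -` B \<inter> S_dom)"
      by (simp add: image_comp)
    then show ?case using Ftilde_image_sets[OF Suc] by (simp only:)
  qed
  then show ?thesis by auto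
qed

lemma \<G>_subset: "\<G> \<subseteq> sets S_measure"
  unfolding forward_generated_def by (rule sets.sigma_sets_subset[OF generators_subset])

text \<open>The map is bijective on the domain, so taking images commutes with complements and
  shifts the generators by one iterate.\<close>

lemma Ftilde_image_\<G>:
  assumes "A \<in> \<G>"
  shows "Ftilde q ` A \<in> \<G>"
  using assms unfolding forward_generated_def
proof (induction rule: sigma_sets.induct)
  case (Basic A)
  then obtain n B where B: "B \<in> sets mu_F" "A = (Ftilde q ^^ n) ` (fst -` B \<inter> space S_measure)" by auto
  then have "Ftilde q ` A = (Ftilde q ^^ Suc n) ` (fst -` B \<inter> space S_measure)"
    by (simp add: image_comp)
  then have "Ftilde q ` A \<in> generators" using B(1) by blast
  then show ?case by (rule sigma_sets.Basic)
next
  case Empty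
  then show ?case by (simp add: sigma_sets.Empty)
next
  case (Compl A)
  then have "A \<subseteq> S_dom" using \<G>_subset sets_S_measure_iff by (auto simp: forward_generated_def)
  then have "Ftilde q ` (S_dom - A) = S_dom - Ftilde q ` A"
    using Ftilde_inv_S_dom by (auto simp: set_eq_iff Ftilde_image_iff[of A] Ftilde_image_iff[of "S_dom - A"])
  then show ?case using sigma_sets.Compl[OF Compl.IH] by simp
next
  case (Union A)
  then show ?case unfolding image_UN by (intro sigma_sets.Union)
qed

text \<open>Makes \<open>\<G>\<close> the sets of a measurable space, so that closure properties of
  measurable functions apply to it.\<close>

definition extension_space :: "(real \<times> real) measure" where
  "extension_space = sigma S_dom generators"

lemma space_extension_space [simp]: "space extension_space = S_dom"
  by (simp add: extension_space_def space_measure_of_conv)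

lemma sets_extension_space: "sets extension_space = \<G>"
proof -
  have "generators \<subseteq> Pow S_dom"
    using order_trans[OF generators_subset sets.space_closed] by (simp only: space_S_measure)
  from sets_measure_of[OF this] show ?thesis
    unfolding extension_space_def forward_generated_def space_S_measure .
qed

lemma fst_vimage_\<G>:
  assumes "B \<in> sets borel"
  shows "fst -` B \<inter> S_dom \<in> \<G>"
proof -
  have "B \<inter> {0<..1} \<in> sets mu_F" using assms by (simp add: sets_mu_F_iff)
  then have "(Ftilde q ^^ 0) ` (fst -` (B \<inter> {0<..1}) \<inter> space S_measure) \<in> generators" by blast
  moreover have "(Ftilde q ^^ 0) ` (fst -` (B \<inter> {0<..1}) \<inter> space S_measure) = fst -` B \<inter> S_dom"
    by (auto simp: S_dom_eq)
  ultimately have "fst -` B \<inter> S_dom \<in> generators" by (simp only:)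
  then show ?thesis unfolding forward_generated_def by (rule sigma_sets.Basic)
qed

lemma H_set_\<G>:
  assumes "j \<le> q - 2"
  shows "H_set q j \<in> \<G>"
proof -
  have "V_set q i \<in> \<G>" if i: "i \<le> q - 2" for i
  proof -
    have "V_set q i = fst -` I_set q i \<inter> S_dom" using V_set_iff_fst[OF i] by auto
    then show ?thesis using fst_vimage_\<G>[of "I_set q i"] I_set_eq[OF i] by simp
  qed
  then have "Ftilde q ` V_set q (q - 2 - j) \<in> \<G>" by (intro Ftilde_image_\<G>) simp
  moreover have "Ftilde q ` V_set q (q - 2 - j) = H_set q (q - 2 - (q - 2 - j))"
    by (rule Ftilde_V_set) simp
  moreover have "q - 2 - (q - 2 - j) = j" using assms by simp
  ultimately show ?thesis by (simp only:)
qed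

text \<open>The heights whose sublevel sets of \<open>tcoord\<close> are already known to be
  generated; they will be dense because they contain 0 and are closed under the branches.\<close>

definition cuts :: "real set" where
  "cuts = {e. 0 \<le> e \<and> {p \<in> S_dom. tcoord p < e} \<in> \<G>}"

lemma zero_in_cuts: "0 \<in> cuts"
proof -
  have empty: "{p \<in> S_dom. tcoord p < 0} = {}" using tcoord_nonneg by force
  show ?thesis unfolding cuts_def mem_Collect_eq empty
    by (simp add: forward_generated_def sigma_sets.Empty)
qed

text \<open>The sublevel set at \<open>branch j e\<close> consists of the horizontal pieces below
  \<open>j\<close> and, within piece \<open>j\<close>, the image of the sublevel set at
  \<open>e\<close>.\<close>

lemma branch_in_cuts:
  assumes j: "j \<le> q - 2" and e: "e \<in> cuts"
  shows "branch j e \<in> cuts"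
proof -
  define i where "i = q - 2 - j"
  have i: "i \<le> q - 2" and j_eq: "j = q - 2 - i" using j by (auto simp: i_def)
  have e0: "e \<ge> 0" and A: "{p \<in> S_dom. tcoord p < e} \<in> \<G>" using e by (auto simp: cuts_def)
  let ?A = "{p \<in> S_dom. tcoord p < e}"
  have inside: "p \<in> Ftilde q ` ?A \<longleftrightarrow> tcoord p < branch j e" if p: "p \<in> H_set q j" for p
  proof -
    obtain p' where p': "p' \<in> V_set q i" "p = Ftilde q p'"
      using p Ftilde_V_set[OF i] unfolding j_eq by (metis imageE)
    then have S: "p' \<in> S_dom" using V_set_iff[OF i] by blast
    then have "p \<in> Ftilde q ` ?A \<longleftrightarrow> tcoord p' < e"
      using p' Ftilde_inv_Ftilde Ftilde_S_dom by (subst Ftilde_image_iff) auto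
    also have "\<dots> \<longleftrightarrow> tcoord p < branch j e"
      using Ftilde_coords(3)[OF i p'(1)] branch_less_iff[OF j tcoord_nonneg[OF S] e0]
      by (simp add: p'(2) j_eq)
    finally show ?thesis .
  qed
  \<comment> \<open>As \<open>branch j e\<close> lies in \<open>cell j\<close>, a point outside that
    piece is below it exactly when it is below the left end of the cell.\<close>
  have outside: "tcoord p < branch j e \<longleftrightarrow> (\<exists>k<j. p \<in> H_set q k)" if p: "p \<in> S_dom" "p \<notin> H_set q j" for p
  proof -
    have "tcoord p < branch j 0 \<longleftrightarrow> tcoord p < branch j e"
    proof
      assume "tcoord p < branch j 0"
      then show "tcoord p < branch j e"
        using branch_less_iff[OF j, of 0 e] e0 by (cases "e = 0") auto
    next
      assume *: "tcoord p < branch j e"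
      have "X (Suc j) * tcoord p < X j"
        using * branch_in_cell[OF j e0] entries(2)[OF j]
        by (smt (verit) cell_def mem_Collect_eq mult_left_mono)
      then have "\<not> Y j \<le> X j * tcoord p" using p H_set_iff[OF j] by (simp add: cell_def)
      then show "tcoord p < branch j 0"
        using entries(1)[OF j] by (simp add: branch_0 pos_less_divide_eq mult.commute)
    qed
    moreover have "(\<exists>k<j. tcoord p \<in> cell k) \<longleftrightarrow> (\<exists>k<j. p \<in> H_set q k)"
      using H_set_iff p(1) j by (intro ex_cong1 conj_cong) simp_all
    ultimately show ?thesis using cell_less_iff[OF j tcoord_nonneg[OF p(1)]] by simp
  qed
  have disjoint: "\<not> (\<exists>k<j. p \<in> H_set q k)" if p: "p \<in> H_set q j" for p
  proof
    assume "\<exists>k<j. p \<in> H_set q k"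
    then obtain k where k: "k < j" "p \<in> H_set q k" by blast
    moreover have "k \<le> q - 2" using k j by simp
    moreover have "p \<in> S_dom" using p H_set_iff[OF j] by simp
    ultimately have "k = j" using H_set_ex1[of p] p j by blast
    then show False using k by simp
  qed
  have char: "tcoord p < branch j e \<longleftrightarrow> p \<in> Ftilde q ` ?A \<inter> H_set q j \<or> (\<exists>k<j. p \<in> H_set q k)"
    if "p \<in> S_dom" for p
    using inside[of p] outside[OF that] disjoint[of p] by (cases "p \<in> H_set q j") auto
  have H: "p \<in> S_dom" if "p \<in> H_set q k" for p k using that by (auto simp: H_set_def)
  have "{p \<in> S_dom. tcoord p < branch j e} =
      (Ftilde q ` ?A \<inter> H_set q j) \<union> (\<Union>k\<in>{..<j}. H_set q k)"
  proof (intro set_eqI)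
    fix p
    show "p \<in> {p \<in> S_dom. tcoord p < branch j e} \<longleftrightarrow>
      p \<in> (Ftilde q ` ?A \<inter> H_set q j) \<union> (\<Union>k\<in>{..<j}. H_set q k)"
      using char[of p] by (cases "p \<in> S_dom") (auto dest: H)
  qed
  moreover have "(Ftilde q ` ?A \<inter> H_set q j) \<union> (\<Union>k\<in>{..<j}. H_set q k) \<in> sets extension_space"
    using Ftilde_image_\<G>[OF A] H_set_\<G> j by (intro sets.Un sets.Int sets.finite_UN) (simp_all add: sets_extension_space)
  ultimately show ?thesis using branch_nonneg[OF j e0] by (simp add: cuts_def sets_extension_space)
qed

lemma tcoord_measurable_\<G>: "tcoord \<in> borel_measurable extension_space"
proof (rule borel_measurableI_less)
  fix e :: real
  show "{p \<in> space extension_space. tcoord p < e} \<in> sets extension_space"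
  proof (cases "e \<le> 0")
    case True
    then have empty: "{p \<in> S_dom. tcoord p < e} = {}" using tcoord_nonneg by force
    show ?thesis by (simp only: space_extension_space empty sets.empty_sets)
  next
    case False
    \<comment> \<open>Cuts approach \<open>e\<close> from below; the maximum with 0 keeps the
      interval in the half-line where density is known.\<close>
    have "\<exists>d\<in>cuts. max 0 (e - 1 / real (Suc n)) \<le> d \<and> d \<le> e" for n
      using False by (intro branch_closed_dense zero_in_cuts branch_in_cuts) auto
    then have "\<forall>n. \<exists>d. d \<in> cuts \<and> e - 1 / real (Suc n) \<le> d \<and> d \<le> e" by fastforce
    from choice[OF this] obtain d
      where d: "\<And>n. d n \<in> cuts" "\<And>n. e - 1 / real (Suc n) \<le> d n" "\<And>n. d n \<le> e" by blast
    have "{p \<in> S_dom. tcoord p < e} = (\<Union>n. {p \<in> S_dom. tcoord p < d n})"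
    proof (intro equalityI subsetI)
      fix p assume p: "p \<in> {p \<in> S_dom. tcoord p < e}"
      then obtain n where "inverse (real (Suc n)) < e - tcoord p"
        using reals_Archimedean[of "e - tcoord p"] by auto
      then have "tcoord p < d n" using d(2)[of n] by (simp add: inverse_eq_divide)
      then show "p \<in> (\<Union>n. {p \<in> S_dom. tcoord p < d n})" using p by auto
    qed (use d(3) in \<open>auto intro: less_le_trans\<close>)
    moreover have "{p \<in> S_dom. tcoord p < d n} \<in> sets extension_space" for n
      using d(1)[of n] by (simp add: cuts_def sets_extension_space)
    ultimately show ?thesis by simp
  qed
qed

text \<open>The identity is a measurable function of \<open>fst\<close> and \<open>tcoord\<close>,
  both measurable for \<open>\<G>\<close>. The equality is exact, not only modulo null sets.\<close>

lemma forward_generated_eq: "\<G> = sets S_measure"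
proof
  show "sets S_measure \<subseteq> \<G>"
  proof
    fix A assume "A \<in> sets S_measure"
    then have A: "A \<in> sets borel" "A \<subseteq> S_dom" by (auto simp: sets_S_measure_iff)
    have fst: "fst \<in> borel_measurable extension_space"
      by (rule measurableI) (auto simp: sets_extension_space fst_vimage_\<G>)
    note [measurable] = fst tcoord_measurable_\<G>
    have "(\<lambda>p. (fst p, tcoord p / (fst p * (fst p + tcoord p * (1 - fst p))))) \<in> borel_measurable extension_space"
      by measurable
    moreover have "(fst p, tcoord p / (fst p * (fst p + tcoord p * (1 - fst p)))) = p"
      if "p \<in> space extension_space" for p
      using that snd_eq_tcoord[of "fst p" "snd p"] by (simp add: prod_eq_iff)
    ultimately have "(\<lambda>p. p) \<in> borel_measurable extension_space"
      by (rule measurable_cong[THEN iffD1, rotated])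
    from measurable_sets[OF this A(1)] show "A \<in> \<G>"
      using A(2) by (simp add: sets_extension_space Int_absorb2)
  qed
qed (rule \<G>_subset)

lemma natural_extension_Ftilde: "natural_extension S_measure (Ftilde q) mu_F (F_map q) fst"
  unfolding natural_extension_def
proof (intro conjI)
  show "equal_mod_null S_measure (sets S_measure) \<G>"
    unfolding forward_generated_eq by (rule equal_mod_null_refl)
  show "\<forall>p\<in>space S_measure. fst (Ftilde q p) = F_map q (fst p)" by (simp add: fst_Ftilde)
qed (rule Ftilde_measure_preserving Ftilde_essentially_invertible fst_measurable_mu_F
    distr_fst_S_measure)+

end

theorem theorem4p1:
  fixes q :: nat
  assumes "q \<ge> 3"
  shows
    \<comment> \<open>the map on the domain is well defined by the matrix equation\<close>
    "(\<forall>p\<in>S_dom. \<exists>!i. i \<le> q - 2 \<and> p \<in> V_set q i)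
   \<and> (\<forall>i\<le>q - 2. \<forall>p\<in>V_set q i. 0 < hecke_rho q i (fst p) \<and>
        (\<exists>!p'. Ftilde_rel q i p p') \<and> Ftilde_rel q i p (Ftilde q p))
   \<and> Ftilde q \<in> S_dom \<rightarrow> S_dom
    \<comment> \<open>invariance of Lebesgue measure and the Markov condition\<close>
   \<and> measure_preserving_map S_measure (Ftilde q)
   \<and> (\<forall>i\<le>q - 2. Ftilde q ` V_set q i = H_set q (q - 2 - i))
    \<comment> \<open>the interval map is well defined and has the stated explicit form\<close>
   \<and> (\<forall>a\<in>{0<..1}. \<exists>!i. i \<le> q - 2 \<and> a \<in> I_set q i)
   \<and> (\<forall>i\<le>q - 2. I_set q i =
        {wx q (i + 1) / (wx q (i + 1) + wy q (i + 1)) <.. wx q i / (wx q i + wy q i)})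
   \<and> (\<forall>i\<le>q - 2. \<forall>a\<in>I_set q i.
        ereal (F_map q a) = 1 / (1 + slope (matrix_inv (hecke_M q i) *v vector [a, 1 - a])) \<and>
        F_map q a = ((wx q (i + 1) + wy q (i + 1)) * a - wx q (i + 1)) /
                    ((wx q (i + 1) - wy q i) * a + (wx q i - wx q (i + 1))))
   \<and> F_map q \<in> {0<..1} \<rightarrow> {0<..1}
    \<comment> \<open>natural extension; the factor measure is the fiber integral of Lebesgue measure\<close>
   \<and> mu_F = density (restrict_space lborel {0<..1}) (\<lambda>a. emeasure lborel {s. (a, s) \<in> S_dom})
   \<and> natural_extension S_measure (Ftilde q) mu_F (F_map q) fst
    \<comment> \<open>the invariant measure of the interval map\<close>
   \<and> measure_preserving_map mu_F (F_map q)"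
proof -
  interpret hecke q by unfold_locales (rule assms)
  have rel: "0 < hecke_rho q i (fst p) \<and> (\<exists>!p'. Ftilde_rel q i p p') \<and> Ftilde_rel q i p (Ftilde q p)"
    if "i \<le> q - 2" "p \<in> V_set q i" for i p
    using rho_pos[OF that(1)] V_set_iff_fst[OF that(1)] Ftilde_rel_iff[OF that] Ftilde_eq_step[OF that] that
    by simp
  have F: "F_map q a = ((X (i + 1) + Y (i + 1)) * a - X (i + 1)) / ((X (i + 1) - Y i) * a + (X i - X (i + 1)))"
    if "i \<le> q - 2" "a \<in> I_set q i" for i a
    using F_map_eq(1)[OF that] by (simp add: numer_def hecke_rho_def algebra_simps)
  have I: "I_set q i = {X (i + 1) / (X (i + 1) + Y (i + 1)) <.. X i / (X i + Y i)}"
    if "i \<le> q - 2" for i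
    using I_set_eq[OF that] by simp
  have maps: "Ftilde q \<in> S_dom \<rightarrow> S_dom" "F_map q \<in> {0<..1} \<rightarrow> {0<..1}"
    using Ftilde_S_dom F_map_range by blast+
  show ?thesis
    apply (intro conjI)
    subgoal using V_set_ex1 by (intro ballI)
    subgoal using rel by (intro allI impI ballI)
    subgoal by (rule maps)
    subgoal by (rule Ftilde_measure_preserving)
    subgoal using Ftilde_V_set by (intro allI impI)
    subgoal using I_set_ex1 by (intro ballI)
    subgoal using I by (intro allI impI)
    subgoal using F F_map_eq(2) by (intro allI impI ballI conjI)
    subgoal by (rule maps)
    subgoal by (rule mu_F_eq)
    subgoal by (rule natural_extension_Ftilde)
    subgoal by (rule F_map_measure_preserving)
    done
qed

end
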